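(* Let $X_1, \dots, X_n$ be independent random vectors with values in a normed space $\mathcal{S}$ over the reals with norm $\|\cdot\|$, and let $\alpha_1, \dots, \alpha_n \in (0, 1]$. Assume that $\tilde{\mathcal{Q}}(X_i,1) \le \alpha_i$ for each $i\in\{1,\dots,n\}$ and that there is a line $L$ in $\mathcal{S}$ such that for each $i$ we have $\sup_{\omega} d(X_i(\omega),L) < \frac 1 8$ (if $\mathcal{S}$ is a Hilbert space, it suffices to assume $\sup_{\omega} d(X_i(\omega),L) < \frac{\sqrt 3}{4}$ for each $i$). If either (i) the random vectors $X_i$ have countable supports; or (ii) $\mathcal{S}$ is complete and separable; then $$\tilde{\mathcal{Q}}(X_1+\dots+X_n, 1) \le \tilde{\mathcal{Q}}(Y_1 + \dots + Y_n, 1) = \mathbb{P}\left(Y_1 + \dots + Y_n \in \{0, \tfrac 1 2\}\right),$$ where $Y_1, \dots, Y_n$ are independent real random variables and $Y_i$ has distribution $\nu^*_{\alpha_i}$.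
   Context: For a random vector $X$ with values in a metric space and $t>0$, $\tilde{\mathcal{Q}}(X,t) = \sup_S \mathbb{P}(X \in S)$, where the supremum is over all open sets $S$ of diameter at most $t$. In a normed space the distance is $d(x,y)=\|x-y\|$, and $d(x,S)=\inf_{y\in S}d(x,y)$ for a set $S$; for real random variables the distance is $|x-y|$. A line in $\mathcal{S}$ is a set $\{t\upsilon+b: t\in\mathbb{R}\}$ with $\upsilon,b\in\mathcal{S}$, $\|\upsilon\|=1$. For a finite set $A$ let $\nu(A)$ be the uniform probability measure on $A$. For $\alpha\in(0,1]$ let $k=\lfloor \alpha^{-1}\rfloor$, let $p=p(\alpha)\in(0,1]$ be the unique number with $\frac pk+\frac{1-p}{k+1}=\alpha$, and define the probability measure on $\mathbb{R}$ $$\nu^*_\alpha = p\,\nu\left(\{1,2,\dots,k\}-\tfrac{k+1}{2}\right)+(1-p)\,\nu\left(\{1,2,\dots,k+1\}-\tfrac{k+2}{2}\right).$$ *)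

theory Defs
  imports "HOL-Probability.Probability"
begin

text \<open>
  The supremum of P(X in S) over the open sets S of diameter at most t.
  \<^item> The library's \<^const>\<open>diameter\<close> is a real number and is meaningful only for bounded sets, so
    boundedness is required explicitly.
  \<^item> Probabilities are taken in the completion. For a Borel measurable X this changes nothing, but
    a sum of random vectors which take values in a countable set only almost surely may, in a
    nonseparable space, be measurable only up to null sets.
\<close>

definition concentration :: "'a measure \<Rightarrow> ('a \<Rightarrow> 'b::metric_space) \<Rightarrow> real \<Rightarrow> real" where
  "concentration M X t =
     (SUP S\<in>{S. open S \<and> bounded S \<and> diameter S \<le> t}. measure (completion M) (X -` S \<inter> space M))"

lemma concentration_measurable:
  assumes "X \<in> borel_measurable M"
  shows "concentration M X t =
    (SUP S\<in>{S. open S \<and> bounded S \<and> diameter S \<le> t}. measure M (X -` S \<inter> space M))"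
  unfolding concentration_def
proof (intro SUP_cong refl)
  fix S :: "'b set" assume "S \<in> {S. open S \<and> bounded S \<and> diameter S \<le> t}"
  then have "X -` S \<inter> space M \<in> sets M"
    using measurable_sets[OF assms] by auto
  then show "measure (completion M) (X -` S \<inter> space M) = measure M (X -` S \<inter> space M)"
    by simp
qed

definition line :: "'b::real_normed_vector set \<Rightarrow> bool" where
  "line L \<longleftrightarrow> (\<exists>v b. norm v = 1 \<and> L = {t *\<^sub>R v + b | t. True})"

text \<open>
  Being a Hilbert space, as a property of a normed space (positive definiteness of the
  inner product \<open>ip\<close> follows from the last clause).
\<close>

definition hilbert_space :: "'b::real_normed_vector itself \<Rightarrow> bool" where
  "hilbert_space _ \<longleftrightarrow> Topological_Spaces.complete (UNIV :: 'b set) \<and>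
     (\<exists>ip :: 'b \<Rightarrow> 'b \<Rightarrow> real.
        (\<forall>x y. ip x y = ip y x) \<and>
        (\<forall>x y z. ip (x + y) z = ip x z + ip y z) \<and>
        (\<forall>r x y. ip (r *\<^sub>R x) y = r * ip x y) \<and>
        (\<forall>x. ip x x = (norm x)\<^sup>2))"

lemma hilbert_space_real_inner: "hilbert_space TYPE('b::{real_inner, complete_space})"
  unfolding hilbert_space_def
  by (intro conjI complete_UNIV exI[of _ inner])
    (auto simp: power2_norm_eq_inner inner_left_distrib intro: inner_commute)

definition nu_star_k :: "real \<Rightarrow> nat" where
  "nu_star_k \<alpha> = nat \<lfloor>1 / \<alpha>\<rfloor>"

definition nu_star_p :: "real \<Rightarrow> real" where
  "nu_star_p \<alpha> = (THE p. 0 < p \<and> p \<le> 1 \<and>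
     p / real (nu_star_k \<alpha>) + (1 - p) / (real (nu_star_k \<alpha>) + 1) = \<alpha>)"

text \<open>The set \<open>{1, \<dots>, k} - (k + 1) / 2\<close>.\<close>

definition centered :: "nat \<Rightarrow> real set" where
  "centered k = (\<lambda>j. real j - (real k + 1) / 2) ` {1..k}"

definition nu_star_pmf :: "real \<Rightarrow> real pmf" where
  "nu_star_pmf \<alpha> = bind_pmf (bernoulli_pmf (nu_star_p \<alpha>))
     (\<lambda>b. if b then pmf_of_set (centered (nu_star_k \<alpha>))
               else pmf_of_set (centered (nu_star_k \<alpha> + 1)))"

definition nu_star :: "real \<Rightarrow> real measure" where
  "nu_star \<alpha> = distr (measure_pmf (nu_star_pmf \<alpha>)) borel (\<lambda>x. x)"

lemma nu_star_p_unique: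
  assumes "0 < \<alpha>" "\<alpha> \<le> 1"
  shows "\<exists>!p. 0 < p \<and> p \<le> 1 \<and>
    p / real (nu_star_k \<alpha>) + (1 - p) / (real (nu_star_k \<alpha>) + 1) = \<alpha>"
proof -
  define k where "k = real (nu_star_k \<alpha>)"
  have fl: "1 \<le> \<lfloor>1 / \<alpha>\<rfloor>" using assms by (simp add: le_floor_iff)
  then have kf: "k = real_of_int \<lfloor>1 / \<alpha>\<rfloor>" unfolding k_def nu_star_k_def by (intro of_nat_nat) linarith
  have k1: "k \<ge> 1" using fl kf by simp
  have "k \<le> 1 / \<alpha>" "1 / \<alpha> < k + 1" unfolding kf by linarith+
  then have b: "k * \<alpha> \<le> 1" "1 < (k + 1) * \<alpha>" using assms by (auto simp: field_simps)
  have eq: "p / k + (1 - p) / (k + 1) = \<alpha> \<longleftrightarrow> p = k * ((k + 1) * \<alpha> - 1)" for p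
    using k1 by (simp add: divide_simps) (auto simp: algebra_simps)
  have "k * ((k + 1) * \<alpha> - 1) \<le> 1"
  proof -
    have "(k + 1) * (k * \<alpha>) \<le> (k + 1) * 1" using b k1 by (intro mult_left_mono) auto
    then show ?thesis by (simp add: algebra_simps)
  qed
  moreover have "0 < k * ((k + 1) * \<alpha> - 1)" using b k1 by simp
  ultimately show ?thesis unfolding k_def[symmetric] eq by blast
qed

lemma nu_star_p:
  assumes "0 < \<alpha>" "\<alpha> \<le> 1"
  shows "0 < nu_star_p \<alpha>" "nu_star_p \<alpha> \<le> 1"
    "nu_star_p \<alpha> / real (nu_star_k \<alpha>) + (1 - nu_star_p \<alpha>) / (real (nu_star_k \<alpha>) + 1) = \<alpha>"
  using theI'[OF nu_star_p_unique[OF assms]] unfolding nu_star_p_def by auto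

lemma measure_nu_star:
  assumes "0 < \<alpha>" "\<alpha> \<le> 1" "B \<in> sets borel"
  shows "measure (nu_star \<alpha>) B =
    nu_star_p \<alpha> * (card (centered (nu_star_k \<alpha>) \<inter> B) / card (centered (nu_star_k \<alpha>)))
    + (1 - nu_star_p \<alpha>) * (card (centered (nu_star_k \<alpha> + 1) \<inter> B) / card (centered (nu_star_k \<alpha> + 1)))"
proof -
  have "1 \<le> \<lfloor>1 / \<alpha>\<rfloor>" using assms by (simp add: le_floor_iff)
  then have "nu_star_k \<alpha> \<ge> 1" unfolding nu_star_k_def by linarith
  then have ne: "centered (nu_star_k \<alpha>) \<noteq> {}" "centered (nu_star_k \<alpha> + 1) \<noteq> {}"
    by (auto simp: centered_def)
  have fin: "finite (centered k)" for k by (simp add: centered_def)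
  have "measure (nu_star \<alpha>) B = measure_pmf.prob (nu_star_pmf \<alpha>) B"
    unfolding nu_star_def using assms by (subst measure_distr) auto
  also have "\<dots> = measure_pmf.expectation (bernoulli_pmf (nu_star_p \<alpha>))
    (\<lambda>b. measure_pmf.prob (if b then pmf_of_set (centered (nu_star_k \<alpha>))
               else pmf_of_set (centered (nu_star_k \<alpha> + 1))) B)"
    unfolding nu_star_pmf_def measure_pmf_bind
    by (rule measure_pmf.measure_bind[where N = "count_space UNIV"])
      (auto simp: measurable_def space_subprob_algebra
        intro: prob_space_imp_subprob_space measure_pmf.prob_space_axioms)
  also have "\<dots> = nu_star_p \<alpha> * measure_pmf.prob (pmf_of_set (centered (nu_star_k \<alpha>))) B
    + (1 - nu_star_p \<alpha>) * measure_pmf.prob (pmf_of_set (centered (nu_star_k \<alpha> + 1))) B"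
    using nu_star_p[OF assms(1,2)] by simp
  finally show ?thesis using ne fin by (simp add: measure_pmf_of_set)
qed

end

theory Submission
  imports Defs
begin

text \<open>
  Points near the line are partially ordered by: \<open>x\<close> lies before \<open>y\<close> along the line and
  \<open>\<parallel>x - y\<parallel> \<ge> 1\<close>. Sets of small diameter are antichains of this order, so \<open>\<alpha>\<^sub>i\<close> bounds the
  \<open>X\<^sub>i\<close>-probability of antichains. The bounds \<open>1 / 8\<close> and \<open>\<surd>3 / 4\<close> make increments of comparable
  pairs add up to vectors of norm at least 1, so tuples whose sums lie in a set of small diameter
  form an antichain of the product order. It remains to bound the weight of such an antichain.

  By induction on the number of factors, a set of tuples without chains of more than \<open>m\<close> elements
  has weight at most \<open>P (Y\<^sub>1 + \<dots> + Y\<^sub>n \<in> {(1 - m) / 2, \<dots>, m / 2})\<close>. Over a chain in the new factor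
  the set is split into hooks, as in the decomposition of a product of two chains into symmetric
  chains; duality between chains and antichains extends this from chains to arbitrary weights, and
  the concavity of the bound in the length of the chain produces the mixture
  \<open>\<nu>\<^sup>*\<^sub>\<alpha>\<close> of uniform distributions on \<open>k\<close> and \<open>k + 1\<close> points.

  General distributions are discretised by a countable partition into small cells.
\<close>

section \<open>Symmetric unimodal sequences on the half-integers\<close>

text \<open>The place \<open>j\<close> stands for the half-integer \<open>j / 2\<close>. A window
  has \<open>m\<close> places of each parity, because convolution with \<open>nu_star\<close> mixes
  progressions of opposite parity; its centre is the place \<open>a + 1 / 2\<close>.\<close>

definition window :: "(int \<Rightarrow> real) \<Rightarrow> nat \<Rightarrow> int \<Rightarrow> real" where
  "window f m a = (\<Sum>j\<in>{1 - int m..int m}. f (j + a))"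

text \<open>For symmetric \<open>f\<close> this is the mass of a central window after convolution
  with an \<open>l\<close>-term progression, negative shifts being folded onto nonnegative ones
  (\<open>window_chain_conv\<close>). In this form the increment in \<open>l\<close> is a single
  window.\<close>

definition spread :: "(int \<Rightarrow> real) \<Rightarrow> nat \<Rightarrow> nat \<Rightarrow> real" where
  "spread f l m = (\<Sum>a<l. window f m (int a))"

text \<open>Monotonicity is asked in steps of 2, that is, within each parity class.\<close>

definition sym_unimodal :: "(int \<Rightarrow> real) \<Rightarrow> bool" where
  "sym_unimodal f \<longleftrightarrow>
     (\<forall>j. 0 \<le> f j) \<and> (\<forall>j. f (- j) = f j) \<and> (\<forall>j\<ge>0. f (j + 2) \<le> f j)"

lemma window_0 [simp]: "window f 0 a = 0"
  by (simp add: window_def)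

lemma window_Suc: "window f (Suc m) a = window f m a + f (a - int m) + f (a + int m + 1)"
proof -
  have "{1 - int (Suc m)..int (Suc m)} = insert (- int m) (insert (int m + 1) {1 - int m..int m})"
    by auto
  then show ?thesis
    by (simp add: window_def algebra_simps)
qed

lemma window_shift: "window f m (a + 1) + f (a + 1 - int m) = window f m a + f (a + 1 + int m)"
proof (induction m)
  case (Suc m)
  then show ?case by (simp add: window_Suc algebra_simps)
qed simp

text \<open>The centre \<open>1 / 2 - a\<close> of the left window is the mirror image of the centre
  \<open>a - 1 / 2\<close> of the right one.\<close>

lemma window_reflect:
  assumes "\<And>j. f (- j) = f j"
  shows "window f m (- a) = window f m (a - 1)"
proof (induction m)
  case (Suc m)
  have "f (- a - int m) = f (a + int m)" "f (- a + int m + 1) = f (a - 1 - int m)"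
    using assms[of "a + int m"] assms[of "a - 1 - int m"] by (simp_all add: algebra_simps)
  with Suc show ?case by (simp add: window_Suc)
qed simp

lemma spread_0 [simp]: "spread f l 0 = 0" "spread f 0 m = 0"
  by (simp_all add: spread_def)

lemma spread_Suc: "spread f (Suc l) m = spread f l m + window f m (int l)"
  by (simp add: spread_def)

text \<open>Induction in steps of two: the new outermost shifts are \<open>- (l + 1)\<close> and
  \<open>l + 1\<close>, and reflection turns the first into \<open>l\<close>, so together they
  supply the next two windows of \<open>spread\<close>.\<close>

lemma spread_eq_sum_window:
  assumes "\<And>j. f (- j) = f j"
  shows "(\<Sum>i<l. window f m (2 * int i - (int l - 1))) = spread f l m"
proof (induction l rule: induct_nat_012)
  case (ge2 l)
  have "(\<Sum>i<Suc (Suc l). window f m (2 * int i - (int (Suc (Suc l)) - 1)))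
      = window f m (- (int l + 1)) + (\<Sum>i<l. window f m (2 * int i - (int l - 1)))
        + window f m (int l + 1)"
    by (subst sum.lessThan_Suc_shift) (simp add: algebra_simps)
  also have "window f m (- (int l + 1)) = window f m (int l)"
    using window_reflect[of f m "int l + 1"] assms by simp
  finally show ?case using ge2 by (simp add: spread_Suc algebra_simps)
qed (simp_all add: spread_def)

text \<open>
  The Clebsch--Gordan rule: the product of two chains with \<open>l + 1\<close> and \<open>m + 1\<close> elements is a
  symmetric chain with \<open>l + m + 1\<close> elements together with the product of chains with \<open>l\<close> and
  \<open>m\<close> elements.
\<close>

lemma spread_Suc_Suc:
  assumes "\<And>j. f (- j) = f j"
  shows "spread f (Suc l) (Suc m) = spread f l m + window f (l + m + 1) 0"
proof (induction l)
  case 0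
  then show ?case by (simp add: spread_def)
next
  case (Suc l)
  have "window f (Suc m) (int l + 1) = window f m (int l) + f (int l + 1 + int m) + f (int l + int m + 2)"
    using window_shift[of f m "int l"] by (simp add: window_Suc algebra_simps)
  moreover have "window f (Suc l + m + 1) 0
      = window f (l + m + 1) 0 + f (int l + int m + 1) + f (int l + int m + 2)"
    using assms[of "int l + int m + 1"] by (simp add: window_Suc algebra_simps)
  ultimately show ?case
    using Suc by (simp add: spread_Suc[of _ "Suc _"] spread_Suc[of _ l m] algebra_simps)
qed

lemma sym_unimodalD:
  assumes "sym_unimodal f"
  shows "0 \<le> f j" "f (- j) = f j" "0 \<le> j \<Longrightarrow> f (j + 2) \<le> f j"
  using assms by (simp_all add: sym_unimodal_def)

text \<open>The two places have the same parity and
  \<open>\<bar>a - int k\<bar> \<le> a + int k\<close>; after a reflection if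
  \<open>a < int k\<close>, steps of 2 away from the origin lead from one to the other.\<close>

lemma sym_unimodal_le:
  assumes f: "sym_unimodal f" and "0 \<le> a"
  shows "f (a + int k) \<le> f (a - int k)"
proof -
  have *: "f (i + 2 * int d) \<le> f i" if "0 \<le> i" for i d
  proof (induction d)
    case (Suc d)
    have "f ((i + 2 * int d) + 2) \<le> f (i + 2 * int d)"
      using f that unfolding sym_unimodal_def by simp
    with Suc show ?case by (simp add: algebra_simps)
  qed simp
  show ?thesis
  proof (cases "int k \<le> a")
    case True
    then show ?thesis using *[of "a - int k" k] by (simp add: algebra_simps)
  next
    case False
    then have "f (a + int k) \<le> f (- (a - int k))"
      using *[of "int k - a" "nat a"] \<open>0 \<le> a\<close> by (simp add: algebra_simps)
    also have "f (- (a - int k)) = f (a - int k)"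
      by (rule sym_unimodalD(2)[OF f])
    finally show ?thesis .
  qed
qed

lemma window_nonneg: "sym_unimodal f \<Longrightarrow> 0 \<le> window f m a"
  by (simp add: window_def sum_nonneg sym_unimodalD(1))

text \<open>A shift by one exchanges the place \<open>a + 1 - m\<close> for
  \<open>a + 1 + m\<close>, and \<open>sym_unimodal_le\<close> compares the two.\<close>

lemma window_antimono:
  assumes "sym_unimodal f"
  shows "antimono (\<lambda>a. window f m (int a))"
proof (rule antimonoI, erule lift_Suc_antimono_le[rotated])
  fix a
  show "window f m (int (Suc a)) \<le> window f m (int a)"
    using window_shift[of f m "int a"] sym_unimodal_le[OF assms, of "int a + 1" m]
    by (simp add: algebra_simps)
qed

text \<open>As a function of \<open>l\<close>, \<open>spread\<close> is concave, since its
  increments are the decreasing windows. The slope \<open>c k\<close> is the increment from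
  \<open>k\<close> to \<open>k + 1\<close>, so the line meets the graph at both points; this is what
  makes a mixture on \<open>k\<close> and \<open>k + 1\<close> points extremal.\<close>

lemma spread_tangent:
  fixes m :: nat
  assumes "sym_unimodal f"
  defines "c k \<equiv> window f m (int k)"
  shows "spread f l m - c k * real l \<le> spread f k m - c k * real k"
proof (cases "k \<le> l")
  case True
  then show ?thesis
  proof (induction l rule: dec_induct)
    case (step l)
    have "c l \<le> c k" using window_antimono[OF assms(1)] step unfolding c_def antimono_def by blast
    with step show ?case by (simp add: spread_Suc c_def algebra_simps)
  qed simp
next
  case False
  then have "l \<le> k" by simp
  then show ?thesis
  proof (induction l rule: inc_induct)
    case (step l)
    have "c k \<le> c l" using window_antimono[OF assms(1)] step unfolding c_def antimono_def by simp
    with step show ?case by (simp add: spread_Suc c_def algebra_simps)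
  qed simp
qed

section \<open>Convolution with \<open>nu_star\<close> on the half-integers\<close>

definition chain_conv :: "nat \<Rightarrow> (int \<Rightarrow> real) \<Rightarrow> int \<Rightarrow> real" where
  "chain_conv k f j = (\<Sum>i<k. f (j + 2 * int i - (int k - 1)))"

text \<open>\<open>chain_conv k\<close> convolves with the counting measure on the places
  \<open>1 - k, 3 - k, ..., k - 1\<close>; normalised by \<open>k\<close> and \<open>k + 1\<close>
  and mixed, this becomes convolution with \<open>nu_star \<alpha>\<close> in units of one
  half.\<close>

definition nu_conv :: "real \<Rightarrow> (int \<Rightarrow> real) \<Rightarrow> int \<Rightarrow> real" where
  "nu_conv \<alpha> f j = nu_star_p \<alpha> / real (nu_star_k \<alpha>) * chain_conv (nu_star_k \<alpha>) f j
     + (1 - nu_star_p \<alpha>) / (real (nu_star_k \<alpha>) + 1) * chain_conv (nu_star_k \<alpha> + 1) f j"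

text \<open>\<open>walk \<alpha> n j\<close> is the probability of \<open>Y\<^sub>1 + \<dots> + Y\<^sub>n = j / 2\<close>.\<close>

primrec walk :: "(nat \<Rightarrow> real) \<Rightarrow> nat \<Rightarrow> int \<Rightarrow> real" where
  "walk \<alpha> 0 = (\<lambda>j. if j = 0 then 1 else 0)"
| "walk \<alpha> (Suc n) = nu_conv (\<alpha> (Suc n)) (walk \<alpha> n)"

lemma window_chain_conv:
  assumes "\<And>j. f (- j) = f j"
  shows "window (chain_conv k f) m 0 = spread f k m"
proof -
  have "window (chain_conv k f) m 0
      = (\<Sum>i<k. \<Sum>j\<in>{1 - int m..int m}. f (j + 2 * int i - (int k - 1)))"
    unfolding window_def chain_conv_def by (subst sum.swap) simp
  also have "\<dots> = (\<Sum>i<k. window f m (2 * int i - (int k - 1)))"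
    unfolding window_def by (simp add: algebra_simps)
  also have "\<dots> = spread f k m"
    using assms by (intro spread_eq_sum_window) auto
  finally show ?thesis .
qed

lemma chain_conv_sym:
  assumes "\<And>j. f (- j) = f j"
  shows "chain_conv k f (- j) = chain_conv k f j"
proof -
  have "chain_conv k f (- j) = (\<Sum>i<k. f (j + 2 * int (k - Suc i) - (int k - 1)))"
    unfolding chain_conv_def
  proof (intro sum.cong refl)
    fix i assume "i \<in> {..<k}"
    then have "- j + 2 * int i - (int k - 1) = - (j + 2 * int (k - Suc i) - (int k - 1))"
      by (simp add: of_nat_diff)
    then show "f (- j + 2 * int i - (int k - 1)) = f (j + 2 * int (k - Suc i) - (int k - 1))"
      by (simp only: assms)
  qed
  also have "\<dots> = chain_conv k f j"
    unfolding chain_conv_def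
    by (rule sum.nat_diff_reindex[of "\<lambda>i. f (j + 2 * int i - (int k - 1))"])
  finally show ?thesis .
qed

lemma chain_conv_shift:
  "chain_conv k f (j + 2) + f (j + 1 - int k) = chain_conv k f j + f (j + 1 + int k)"
proof -
  have "chain_conv k f (j + 2) - chain_conv k f j
      = (\<Sum>i<k. f (j + 2 * int (Suc i) - (int k - 1)) - f (j + 2 * int i - (int k - 1)))"
    unfolding chain_conv_def sum_subtractf by (simp add: algebra_simps)
  also have "\<dots> = f (j + 1 + int k) - f (j + 1 - int k)"
    by (subst sum_lessThan_telescope) (simp add: algebra_simps)
  finally show ?thesis by simp
qed

text \<open>A step of 2 exchanges \<open>f (j + 1 - k)\<close> for \<open>f (j + 1 + k)\<close>,
  which is no larger when \<open>0 \<le> j\<close>.\<close>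

lemma sym_unimodal_chain_conv:
  assumes "sym_unimodal f"
  shows "sym_unimodal (chain_conv k f)"
  unfolding sym_unimodal_def
proof (intro conjI allI impI)
  show "0 \<le> chain_conv k f j" for j
    by (simp add: chain_conv_def sum_nonneg sym_unimodalD(1)[OF assms])
  show "chain_conv k f (- j) = chain_conv k f j" for j
    by (rule chain_conv_sym) (rule sym_unimodalD(2)[OF assms])
  show "chain_conv k f (j + 2) \<le> chain_conv k f j" if "0 \<le> j" for j
    using chain_conv_shift[of k f j] sym_unimodal_le[OF assms, of "j + 1" k] that by simp
qed

lemma sym_unimodal_nu_conv:
  assumes "sym_unimodal f" "0 < \<alpha>" "\<alpha> \<le> 1"
  shows "sym_unimodal (nu_conv \<alpha> f)"
proof -
  define a where "a = nu_star_p \<alpha> / real (nu_star_k \<alpha>)"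
  define b where "b = (1 - nu_star_p \<alpha>) / (real (nu_star_k \<alpha>) + 1)"
  have "a \<ge> 0" "b \<ge> 0"
    using nu_star_p(1,2)[OF assms(2,3)] by (simp_all add: a_def b_def)
  note ab = this
  have *: "sym_unimodal (chain_conv k f)" for k
    by (rule sym_unimodal_chain_conv[OF assms(1)])
  have eq: "nu_conv \<alpha> f j = a * chain_conv (nu_star_k \<alpha>) f j + b * chain_conv (nu_star_k \<alpha> + 1) f j"
    for j by (simp only: nu_conv_def a_def b_def)
  show ?thesis
    unfolding sym_unimodal_def eq
  proof (intro conjI allI impI)
    fix j
    show "0 \<le> a * chain_conv (nu_star_k \<alpha>) f j + b * chain_conv (nu_star_k \<alpha> + 1) f j"
      by (intro add_nonneg_nonneg mult_nonneg_nonneg ab sym_unimodalD(1)[OF *])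
    show "a * chain_conv (nu_star_k \<alpha>) f (- j) + b * chain_conv (nu_star_k \<alpha> + 1) f (- j)
        = a * chain_conv (nu_star_k \<alpha>) f j + b * chain_conv (nu_star_k \<alpha> + 1) f j"
      by (simp only: sym_unimodalD(2)[OF *])
    assume "0 \<le> j"
    then show "a * chain_conv (nu_star_k \<alpha>) f (j + 2) + b * chain_conv (nu_star_k \<alpha> + 1) f (j + 2)
        \<le> a * chain_conv (nu_star_k \<alpha>) f j + b * chain_conv (nu_star_k \<alpha> + 1) f j"
      using sym_unimodalD(3)[OF *] by (intro add_mono mult_left_mono ab) simp_all
  qed
qed

lemma sym_unimodal_walk:
  assumes "\<And>i. i \<in> {1..n} \<Longrightarrow> 0 < \<alpha> i \<and> \<alpha> i \<le> 1"
  shows "sym_unimodal (walk \<alpha> n)"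
  using assms
proof (induction n)
  case 0
  then show ?case by (auto simp: sym_unimodal_def)
next
  case (Suc n)
  then show ?case by (auto intro!: sym_unimodal_nu_conv)
qed

lemma nu_star_k_pos:
  assumes "0 < \<alpha>" "\<alpha> \<le> 1"
  shows "0 < nu_star_k \<alpha>"
proof -
  have "1 \<le> \<lfloor>1 / \<alpha>\<rfloor>" using assms by (simp add: le_floor_iff)
  then show ?thesis by (simp add: nu_star_k_def)
qed

text \<open>By the choice of \<open>c\<close>, both \<open>spread f k m\<close> and
  \<open>spread f (k + 1) m\<close> lie on one line of slope \<open>c\<close>, so the weights enter
  only through the equation that defines \<open>p\<close>. The right-hand side is the form in which
  duality produces the bound in \<open>product_step\<close>.\<close>

lemma window_nu_conv:
  fixes m :: nat and \<alpha> :: real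
  assumes f: "sym_unimodal f" and \<alpha>: "0 < \<alpha>" "\<alpha> \<le> 1"
  defines "k \<equiv> nu_star_k \<alpha>"
  defines "c \<equiv> window f m (int k)"
  shows "window (nu_conv \<alpha> f) m 0 = \<alpha> * (spread f k m - c * real k) + c"
proof -
  define p where "p = nu_star_p \<alpha>"
  define d where "d = spread f k m - c * real k"
  have k: "real k > 0" using nu_star_k_pos[OF \<alpha>] by (simp add: k_def)
  have e: "p / real k + (1 - p) / (real k + 1) = \<alpha>"
    using nu_star_p(3)[OF \<alpha>] by (simp only: p_def k_def)
  have "window (nu_conv \<alpha> f) m 0 = p / real k * window (chain_conv k f) m 0
      + (1 - p) / (real k + 1) * window (chain_conv (k + 1) f) m 0"
    by (simp add: window_def nu_conv_def sum.distrib sum_distrib_left p_def k_def)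
  also have "\<dots> = p / real k * (d + c * real k) + (1 - p) / (real k + 1) * (d + c * (real k + 1))"
    using sym_unimodalD(2)[OF f] by (simp add: window_chain_conv spread_Suc d_def c_def algebra_simps)
  also have "\<dots> = (p / real k + (1 - p) / (real k + 1)) * d + c"
    using k by (simp add: divide_simps) (simp add: algebra_simps)
  finally show ?thesis by (simp add: e d_def)
qed

section \<open>Chains and antichains in finite posets\<close>

definition poset_on :: "'a set \<Rightarrow> ('a \<Rightarrow> 'a \<Rightarrow> bool) \<Rightarrow> bool" where
  "poset_on A le \<longleftrightarrow> reflp_on A le \<and> transp_on A le \<and> antisymp_on A le"

text \<open>Antichains are the case \<open>m = 1\<close>; larger \<open>m\<close> occur because the
  induction on the factors passes through sets of greater height.\<close>

definition height_le :: "('a \<Rightarrow> 'a \<Rightarrow> bool) \<Rightarrow> 'a set \<Rightarrow> nat \<Rightarrow> bool" where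
  "height_le le T m \<longleftrightarrow>
     (\<forall>C\<subseteq>T. finite C \<longrightarrow> Complete_Partial_Order.chain le C \<longrightarrow> card C \<le> m)"

definition prod_le :: "('a \<Rightarrow> 'a \<Rightarrow> bool) \<Rightarrow> ('b \<Rightarrow> 'b \<Rightarrow> bool) \<Rightarrow> 'a \<times> 'b \<Rightarrow> 'a \<times> 'b \<Rightarrow> bool" where
  "prod_le le1 le2 u v \<longleftrightarrow> le1 (fst u) (fst v) \<and> le2 (snd u) (snd v)"

lemma poset_onD:
  assumes "poset_on A le"
  shows "x \<in> A \<Longrightarrow> le x x"
    and "x \<in> A \<Longrightarrow> y \<in> A \<Longrightarrow> z \<in> A \<Longrightarrow> le x y \<Longrightarrow> le y z \<Longrightarrow> le x z"
    and "x \<in> A \<Longrightarrow> y \<in> A \<Longrightarrow> le x y \<Longrightarrow> le y x \<Longrightarrow> x = y"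
  using assms by (auto simp: poset_on_def reflp_on_def dest: transp_onD antisymp_onD)

lemma poset_on_converse: "poset_on A le \<Longrightarrow> poset_on A (\<lambda>x y. le y x)"
  unfolding poset_on_def reflp_on_def transp_on_def antisymp_on_def by blast

lemma poset_on_subset: "poset_on A le \<Longrightarrow> B \<subseteq> A \<Longrightarrow> poset_on B le"
  unfolding poset_on_def reflp_on_def transp_on_def antisymp_on_def by blast

lemma poset_onI:
  assumes "\<And>x. x \<in> A \<Longrightarrow> le x x"
    and "\<And>x y z. x \<in> A \<Longrightarrow> y \<in> A \<Longrightarrow> z \<in> A \<Longrightarrow> le x y \<Longrightarrow> le y z \<Longrightarrow> le x z"
    and "\<And>x y. x \<in> A \<Longrightarrow> y \<in> A \<Longrightarrow> le x y \<Longrightarrow> le y x \<Longrightarrow> x = y"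
  shows "poset_on A le"
  unfolding poset_on_def
  by (intro conjI reflp_onI transp_onI antisymp_onI) (fact assms)+

lemma poset_on_prod:
  assumes A: "poset_on A le1" and B: "poset_on B le2"
  shows "poset_on (A \<times> B) (prod_le le1 le2)"
proof (rule poset_onI)
  show "prod_le le1 le2 u u" if "u \<in> A \<times> B" for u
    using that poset_onD(1)[OF A] poset_onD(1)[OF B] by (auto simp: prod_le_def)
  show "prod_le le1 le2 u w" if "u \<in> A \<times> B" "v \<in> A \<times> B" "w \<in> A \<times> B"
    "prod_le le1 le2 u v" "prod_le le1 le2 v w" for u v w
    using that poset_onD(2)[OF A, of "fst u" "fst v" "fst w"]
      poset_onD(2)[OF B, of "snd u" "snd v" "snd w"] by (auto simp: prod_le_def)
  show "u = v" if "u \<in> A \<times> B" "v \<in> A \<times> B"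
    "prod_le le1 le2 u v" "prod_le le1 le2 v u" for u v
    using that poset_onD(3)[OF A, of "fst u" "fst v"] poset_onD(3)[OF B, of "snd u" "snd v"]
    by (auto simp: prod_le_def)
qed

lemma exists_minimal_below:
  assumes "poset_on A le" "finite A" "x \<in> A"
  obtains m where "m \<in> A" "le m x" "\<And>y. y \<in> A \<Longrightarrow> le y m \<Longrightarrow> y = m"
proof -
  note le = poset_onD[OF assms(1)]
  let ?B = "{y \<in> A. le y x}"
  let ?d = "\<lambda>y. card {z \<in> A. le z y}"
  define m where "m = arg_min_on ?d ?B"
  have fin: "finite ?B" and ne: "?B \<noteq> {}" using assms(2,3) le(1) by auto
  have m: "m \<in> ?B" "\<not> (\<exists>y\<in>?B. ?d y < ?d m)"
    unfolding m_def by (rule arg_min_if_finite[OF fin ne])+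
  show ?thesis
  proof (rule that)
    show "m \<in> A" "le m x" using m by auto
    fix y assume y: "y \<in> A" "le y m"
    show "y = m"
    proof (rule ccontr)
      assume "y \<noteq> m"
      then have "{z \<in> A. le z y} \<subset> {z \<in> A. le z m}"
        using y m(1) le(1)[of m] le(2)[of _ y m] le(3)[of m y] by blast
      then have "?d y < ?d m" using assms(2) by (intro psubset_card_mono) auto
      moreover have "y \<in> ?B" using y m(1) assms(3) le(2)[of y m x] by auto
      ultimately show False using m(2) by blast
    qed
  qed
qed

lemma finite_chain_bot:
  assumes "poset_on A le" "C \<subseteq> A" "finite C" "C \<noteq> {}" "Complete_Partial_Order.chain le C"
  obtains c where "c \<in> C" "\<And>x. x \<in> C \<Longrightarrow> le c x"
proof -
  have p: "poset_on C le" using assms poset_on_subset by blast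
  obtain x where "x \<in> C" using assms by auto
  from exists_minimal_below[OF p assms(3) this] obtain c where
    c: "c \<in> C" "\<And>y. y \<in> C \<Longrightarrow> le y c \<Longrightarrow> y = c" by metis
  have "le c x" if "x \<in> C" for x
    using assms(5) c that poset_onD(1)[OF p] unfolding chain_def by metis
  with c that show ?thesis by blast
qed

lemma finite_chain_top:
  assumes "poset_on A le" "C \<subseteq> A" "finite C" "C \<noteq> {}" "Complete_Partial_Order.chain le C"
  obtains c where "c \<in> C" "\<And>x. x \<in> C \<Longrightarrow> le x c"
  using finite_chain_bot[OF poset_on_converse[OF assms(1)] assms(2-4)] assms(5)
  unfolding chain_def by metis

text \<open>
  Linear programming duality for antichains and chains: lower \<open>g\<close> on the minimal elements of its
  support until one more element leaves the support.
\<close>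

lemma antichain_chain_duality:
  fixes w g :: "'a \<Rightarrow> real"
  assumes "finite P" and P: "poset_on P le"
    and w: "\<And>A. A \<subseteq> P \<Longrightarrow> (\<And>x y. x \<in> A \<Longrightarrow> y \<in> A \<Longrightarrow> le x y \<Longrightarrow> x = y) \<Longrightarrow> sum w A \<le> \<alpha>"
    and "0 \<le> \<alpha>" "\<And>x. x \<in> P \<Longrightarrow> 0 \<le> g x"
    and "\<And>C. C \<subseteq> P \<Longrightarrow> Complete_Partial_Order.chain le C \<Longrightarrow> sum g C \<le> B"
  shows "(\<Sum>x\<in>P. w x * g x) \<le> \<alpha> * B"
  using assms(5,6)
proof (induction "card {x \<in> P. 0 < g x}" arbitrary: g B rule: less_induct)
  case less
  note le = poset_onD[OF P]
  define S where "S = {x \<in> P. 0 < g x}"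
  have S: "finite S" "S \<subseteq> P" using \<open>finite P\<close> by (auto simp: S_def)
  have zero: "g x = 0" if "x \<in> P" "x \<notin> S" for x
    using that less.prems(1)[of x] by (auto simp: S_def)
  show ?case
  proof (cases "S = {}")
    case True
    have "0 \<le> B" using less.prems(2)[of "{}"] by (simp add: chain_def)
    moreover have "(\<Sum>x\<in>P. w x * g x) = 0" using zero True by (intro sum.neutral) auto
    ultimately show ?thesis using \<open>0 \<le> \<alpha>\<close> by simp
  next
    case False
    \<comment> \<open>The minimal elements of the support form an antichain, so their weight is at
      most \<open>\<alpha>\<close>.\<close>
    define A where "A = {x \<in> S. \<forall>y\<in>S. le y x \<longrightarrow> y = x}"
    have below: "\<exists>a\<in>A. le a x" if x: "x \<in> S" for x
    proof -
      obtain a where "a \<in> S" "le a x" "\<And>y. y \<in> S \<Longrightarrow> le y a \<Longrightarrow> y = a"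
        by (rule exists_minimal_below[OF poset_on_subset[OF P S(2)] S(1) x]) blast
      then show ?thesis unfolding A_def by blast
    qed
    have A: "finite A" "A \<subseteq> S" "A \<noteq> {}" using S False below by (auto simp: A_def)
    \<comment> \<open>The largest amount that can be taken from all of \<open>A\<close> while
      \<open>g\<close> stays nonnegative; nothing is left at \<open>a0\<close>, so the support
      shrinks.\<close>
    define e where "e = Min (g ` A)"
    have "e \<in> g ` A" unfolding e_def using A by (intro Min_in) auto
    then obtain a0 where a0: "a0 \<in> A" "g a0 = e" by auto
    have e: "0 < e" using a0 A by (auto simp: S_def)
    have e_le: "e \<le> g a" if "a \<in> A" for a unfolding e_def using A that by simp
    define g' where "g' x = g x - (if x \<in> A then e else 0)" for x
    have g'_nonneg: "0 \<le> g' x" if "x \<in> P" for x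
      using e_le less.prems(1)[OF that] by (auto simp: g'_def)
    have g'_le: "g' x \<le> g x" for x using e by (simp add: g'_def)
    have "{x \<in> P. 0 < g' x} \<subset> S"
    proof
      show "{x \<in> P. 0 < g' x} \<subseteq> S"
        using g'_le by (auto simp: S_def intro: less_le_trans)
      have "a0 \<in> S" "g' a0 = 0" using a0 A by (auto simp: g'_def)
      then show "{x \<in> P. 0 < g' x} \<noteq> S" by auto
    qed
    then have "card {x \<in> P. 0 < g' x} < card S" using S by (intro psubset_card_mono)
    \<comment> \<open>For the lowered function the bound on chain sums itself drops by
      \<open>e\<close>.\<close>
    then have "(\<Sum>x\<in>P. w x * g' x) \<le> \<alpha> * (B - e)"
      unfolding S_def
    proof (rule less.hyps)
      fix C assume C: "C \<subseteq> P" "Complete_Partial_Order.chain le C"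
      then have finC: "finite C" using \<open>finite P\<close> finite_subset by auto
      define C0 where "C0 = C \<inter> S"
      have C0: "C0 \<subseteq> S" "finite C0" "Complete_Partial_Order.chain le C0"
        using C S by (auto simp: C0_def chain_def intro: finite_subset)
      have "sum g' C \<le> sum g' C0"
        unfolding C0_def sum.inter_restrict[OF finC]
      proof (rule sum_mono)
        fix x assume "x \<in> C"
        then show "g' x \<le> (if x \<in> S then g' x else 0)"
          using zero[of x] g'_le[of x] C by auto
      qed
      \<comment> \<open>A chain that meets \<open>A\<close> loses \<open>e\<close> there. One that
        misses \<open>A\<close> extends downwards by some \<open>a\<close> in \<open>A\<close>, so
        its sum was at most \<open>B - g a\<close> already.\<close>
      also have "\<dots> \<le> B - e"
      proof (cases "C0 \<inter> A = {}")
        case True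
        obtain a where a: "a \<in> A" "\<And>x. x \<in> C0 \<Longrightarrow> le a x"
        proof (cases "C0 = {}")
          case False
          then obtain c where c: "c \<in> C0" "\<And>x. x \<in> C0 \<Longrightarrow> le c x"
            using finite_chain_bot[OF P _ C0(2) _ C0(3)] C0(1) S(2) by (metis subset_trans)
          obtain a where a: "a \<in> A" "le a c" using below c C0 by blast
          moreover have "le a x" if "x \<in> C0" for x
            using le(2)[of a c x] a c that A S C0 by blast
          ultimately show ?thesis using that by blast
        qed (use a0 that in auto)
        have "Complete_Partial_Order.chain le (insert a C0)"
          using C0(3) a le(1)[of a] A S unfolding chain_def by blast
        then have "sum g (insert a C0) \<le> B"
          using a A S C0 by (intro less.prems(2)) auto
        moreover have "sum g (insert a C0) = g a + sum g C0"
          using True a(1) C0 by (intro sum.insert) auto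
        moreover have "sum g' C0 = sum g C0"
          using True by (intro sum.cong) (auto simp: g'_def)
        ultimately show ?thesis using e_le[OF a(1)] by simp
      next
        case False
        then obtain a where a: "a \<in> C0" "a \<in> A" by auto
        have "sum g' C0 = sum g' (C0 - {a}) + g' a"
          using a C0 by (simp add: sum_diff1)
        also have "\<dots> \<le> sum g (C0 - {a}) + (g a - e)"
          using a g'_le by (intro add_mono sum_mono) (auto simp: g'_def)
        also have "\<dots> = sum g C0 - e" using a C0 by (simp add: sum_diff1)
        also have "sum g C0 \<le> B" using C0 S by (intro less.prems(2)) auto
        finally show ?thesis by simp
      qed
      finally show "sum g' C \<le> B - e" .
    qed (rule g'_nonneg)
    moreover have "(\<Sum>x\<in>P. w x * g x) = (\<Sum>x\<in>P. w x * g' x) + e * sum w A"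
    proof -
      have "(\<Sum>x\<in>P. w x * g x) = (\<Sum>x\<in>P. w x * g' x + (if x \<in> A then e * w x else 0))"
        by (intro sum.cong) (auto simp: g'_def algebra_simps)
      also have "\<dots> = (\<Sum>x\<in>P. w x * g' x) + (\<Sum>x\<in>P \<inter> A. e * w x)"
        using \<open>finite P\<close> by (simp add: sum.distrib sum.inter_restrict)
      also have "P \<inter> A = A" using A S by auto
      finally show ?thesis by (simp add: sum_distrib_left)
    qed
    moreover have "sum w A \<le> \<alpha>"
      using A S by (intro w) (auto simp: A_def)
    then have "e * sum w A \<le> e * \<alpha>" using e by (intro mult_left_mono) auto
    ultimately show ?thesis by (simp add: algebra_simps)
  qed
qed

section \<open>Products of weighted posets\<close>

lemma height_leD: "height_le le T m \<Longrightarrow> C \<subseteq> T \<Longrightarrow> finite C \<Longrightarrow> Complete_Partial_Order.chain le C \<Longrightarrow> card C \<le> m"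
  by (simp add: height_le_def)

lemma height_le_subset: "height_le le T m \<Longrightarrow> T' \<subseteq> T \<Longrightarrow> height_le le T' m"
  by (auto simp: height_le_def)

lemma height_le_0D:
  assumes "height_le le T 0" "\<And>x. x \<in> T \<Longrightarrow> le x x"
  shows "T = {}"
proof (rule ccontr)
  assume "T \<noteq> {}"
  then obtain x where "x \<in> T" by auto
  then have "card {x} \<le> 0"
    using assms by (intro height_leD[OF assms(1)]) (auto simp: chain_def)
  then show False by simp
qed

text \<open>A chain in \<open>T'\<close> can be extended by an element of \<open>T\<close> strictly
  above its top.\<close>

lemma height_le_remove_maximal:
  assumes A: "poset_on A le" "T \<subseteq> A" and "height_le le T (Suc m)"
    and T': "T' \<subseteq> T" "\<And>x. x \<in> T' \<Longrightarrow> \<exists>y\<in>T. le x y \<and> y \<noteq> x"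
  shows "height_le le T' m"
  unfolding height_le_def
proof (intro allI impI)
  fix C assume C: "C \<subseteq> T'" "finite C" "Complete_Partial_Order.chain le C"
  show "card C \<le> m"
  proof (cases "C = {}")
    case False
    obtain c where c: "c \<in> C" "\<And>x. x \<in> C \<Longrightarrow> le x c"
      using finite_chain_top[OF A(1) _ C(2) False C(3)] A(2) C(1) T'(1) by blast
    obtain y where y: "y \<in> T" "le c y" "y \<noteq> c" using T'(2) c(1) C(1) by blast
    have y_above: "le x y" if "x \<in> C" for x
      using poset_onD(2)[OF A(1), of x c y] c y that C T' A by blast
    have "y \<notin> C" using poset_onD(3)[OF A(1), of c y] c y C T' A by blast
    moreover have "card (insert y C) \<le> Suc m"
      using C(3) y_above y poset_onD(1)[OF A(1), of y] A C T'
      by (intro height_leD[OF assms(3)]) (auto simp: chain_def)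
    ultimately show ?thesis using C by simp
  qed simp
qed

text \<open>
  The hook consisting of the maximal elements of \<open>T\<close> and of the slice over the top element \<open>c\<close> of
  the chain \<open>C\<close> projects injectively, because below \<open>c\<close> two elements of the hook cannot have
  comparable second components and first components ordered the same way.
\<close>

lemma sum_slices_le:
  fixes v :: "'b \<Rightarrow> real"
  assumes P: "poset_on P le1" and Q: "poset_on Q le2"
    and sym: "\<And>j. f (- j) = f j"
    and bound: "\<And>S h. S \<subseteq> Q \<Longrightarrow> height_le le2 S h \<Longrightarrow> sum v S \<le> window f h 0"
    and "C \<subseteq> P" "finite C" "finite Q" "Complete_Partial_Order.chain le1 C"
    and "T \<subseteq> C \<times> Q" "height_le (prod_le le1 le2) T m"
  shows "(\<Sum>u\<in>T. v (snd u)) \<le> spread f (card C) m"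
  using assms(5,6,8-)
proof (induction "card C" arbitrary: C T m)
  case 0
  then show ?case by simp
next
  case (Suc l)
  note PQ = poset_on_prod[OF P Q]
  have T: "T \<subseteq> P \<times> Q" "finite T"
    using Suc.prems \<open>finite Q\<close> by (blast, meson finite_SigmaI finite_subset)
  have "C \<noteq> {}" using Suc.hyps(2) by auto
  obtain c where c: "c \<in> C" "\<And>x. x \<in> C \<Longrightarrow> le1 x c"
    by (rule finite_chain_top[OF P Suc.prems(1,2) \<open>C \<noteq> {}\<close> Suc.prems(3)]) blast
  show ?case
  proof (cases m)
    case 0
    have "T = {}"
    proof (rule height_le_0D)
      show "height_le (prod_le le1 le2) T 0" using Suc.prems(5) 0 by simp
    qed (use T poset_onD(1)[OF PQ] in blast)
    then show ?thesis using 0 by simp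
  next
    case m: (Suc h)
    define H where "H = {u \<in> T. fst u = c \<or> (\<forall>u'\<in>T. prod_le le1 le2 u u' \<longrightarrow> u' = u)}"
    define T' where "T' = T - H"
    have card: "card (C - {c}) = l" using Suc.hyps(2) Suc.prems(2) c(1) by simp
    \<comment> \<open>Each element outside the hook has a strictly larger one in \<open>T\<close>,
      so removing the hook lowers both the chain length and the height by one.\<close>
    have "(\<Sum>u\<in>T'. v (snd u)) \<le> spread f (card (C - {c})) h"
    proof (rule Suc.hyps(1))
      show "l = card (C - {c})" by (simp add: card)
      show "C - {c} \<subseteq> P" "finite (C - {c})" using Suc.prems by auto
      show "Complete_Partial_Order.chain le1 (C - {c})"
        using Suc.prems(3) by (auto simp: chain_def)
      show "T' \<subseteq> (C - {c}) \<times> Q" using Suc.prems(4) by (auto simp: T'_def H_def)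
      show "height_le (prod_le le1 le2) T' h"
      proof (rule height_le_remove_maximal[OF PQ T(1)])
        show "height_le (prod_le le1 le2) T (Suc h)" using Suc.prems(5) m by simp
        show "\<exists>u'\<in>T. prod_le le1 le2 u u' \<and> u' \<noteq> u" if "u \<in> T'" for u
          using that unfolding T'_def H_def by blast
      qed (simp add: T'_def)
    qed
    moreover have "(\<Sum>u\<in>H. v (snd u)) \<le> window f (l + h + 1) 0"
    proof -
      have maximal: "u' = u" if "u \<in> H" "fst u \<noteq> c" "u' \<in> T" "le1 (fst u) (fst u')"
        "le2 (snd u) (snd u')" for u u'
        using that unfolding H_def prod_le_def by blast
      have HT: "H \<subseteq> T" by (auto simp: H_def)
      have inj: "inj_on snd H"
      proof (rule inj_onI)
        have *: "u = u'" if u: "u \<in> H" "u' \<in> H" "snd u = snd u'" "le1 (fst u) (fst u')" for u u'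
        proof (cases "fst u = c")
          case True
          have "fst u' \<in> C" using u(2) HT Suc.prems(4) by auto
          then have "fst u' = c"
            using True u(4) c Suc.prems(1) by (intro poset_onD(3)[OF P]) auto
          with True u(3) show ?thesis by (simp add: prod_eq_iff)
        next
          case False
          have "le2 (snd u) (snd u')" using u(1,3) HT T(1) poset_onD(1)[OF Q, of "snd u"] by auto
          then show ?thesis using maximal[OF u(1) False _ u(4)] u(2) HT by blast
        qed
        fix u u' assume u: "u \<in> H" "u' \<in> H" "snd u = snd u'"
        have "fst u \<in> C" "fst u' \<in> C" using u(1,2) HT Suc.prems(4) by auto
        then have "le1 (fst u) (fst u') \<or> le1 (fst u') (fst u)"
          using Suc.prems(3) unfolding chain_def by blast
        then show "u = u'" using *[OF u] *[OF u(2,1) u(3)[symmetric]] by auto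
      qed
      have "height_le le2 (snd ` H) (l + h + 1)"
        unfolding height_le_def
      proof (intro allI impI)
        fix D assume D: "D \<subseteq> snd ` H" "finite D" "Complete_Partial_Order.chain le2 D"
        \<comment> \<open>The part of \<open>D\<close> over \<open>c\<close> lifts to a chain in
          \<open>T\<close> and has at most \<open>h + 1\<close> elements. The others come from
          maximal elements of \<open>T\<close>, which lie over distinct points among the remaining
          \<open>l\<close> elements of \<open>C\<close>.\<close>
        define D1 where "D1 = {z \<in> D. (c, z) \<in> T}"
        have "card ({c} \<times> D1) \<le> m"
        proof (rule height_leD[OF Suc.prems(5)])
          show "{c} \<times> D1 \<subseteq> T" by (auto simp: D1_def)
          show "finite ({c} \<times> D1)" using D by (auto simp: D1_def)
          show "Complete_Partial_Order.chain (prod_le le1 le2) ({c} \<times> D1)"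
            using D(3) c by (auto simp: D1_def chain_def prod_le_def)
        qed
        then have D1: "card D1 \<le> Suc h" by (simp add: card_cartesian_product m)
        have "\<exists>x. (x, z) \<in> H" if "z \<in> D" for z using D(1) that by force
        then obtain \<xi> where \<xi>: "\<And>z. z \<in> D \<Longrightarrow> (\<xi> z, z) \<in> H" by metis
        have ne: "\<xi> z \<noteq> c" if "z \<in> D - D1" for z
          using \<xi>[of z] that HT unfolding D1_def by auto
        have "inj_on \<xi> (D - D1)"
        proof (rule inj_onI)
          have *: "z = z'" if z: "z \<in> D - D1" "z' \<in> D - D1" "\<xi> z = \<xi> z'" "le2 z z'" for z z'
          proof -
            have H: "(\<xi> z, z) \<in> H" using \<xi>[of z] z(1) by blast
            have T': "(\<xi> z', z') \<in> T" using \<xi>[of z'] z(2) HT by blast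
            have "le1 (\<xi> z) (\<xi> z')"
              unfolding z(3) using T' T(1) by (intro poset_onD(1)[OF P]) auto
            then show ?thesis using maximal[OF H _ T'] ne[OF z(1)] z(4) by simp
          qed
          fix z z' assume z: "z \<in> D - D1" "z' \<in> D - D1" "\<xi> z = \<xi> z'"
          have "le2 z z' \<or> le2 z' z" using D(3) z unfolding chain_def by blast
          then show "z = z'" using *[OF z] *[OF z(2,1) z(3)[symmetric]] by auto
        qed
        moreover have "\<xi> ` (D - D1) \<subseteq> C - {c}"
          using ne \<xi> HT Suc.prems(4) by blast
        ultimately have "card (D - D1) \<le> l"
          using card_inj_on_le[of \<xi> "D - D1" "C - {c}"] Suc.prems(2) card by simp
        moreover have "card D = card D1 + card (D - D1)"
          using D(2) by (subst card_Un_disjoint[symmetric]) (auto simp: D1_def intro: arg_cong[of _ _ card])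
        ultimately show "card D \<le> l + h + 1" using D1 by simp
      qed
      moreover have "snd ` H \<subseteq> Q" using HT T(1) by auto
      ultimately have "sum v (snd ` H) \<le> window f (l + h + 1) 0" by (intro bound)
      then show ?thesis by (simp add: sum.reindex[OF inj])
    qed
    moreover have "(\<Sum>u\<in>T. v (snd u)) = (\<Sum>u\<in>T'. v (snd u)) + (\<Sum>u\<in>H. v (snd u))"
      unfolding T'_def using T(2) by (intro sum.subset_diff) (auto simp: H_def)
    \<comment> \<open>The remainder and the hook match the two summands of
      \<open>spread f (Suc l) (Suc h)\<close>.\<close>
    ultimately show ?thesis
      using spread_Suc_Suc[of f l h] sym Suc.hyps(2) m card by simp
  qed
qed

text \<open>The weight \<open>g x\<close> of the slice over \<open>x\<close> sums over a chain to at
  most \<open>spread\<close> of the chain length. Subtracting the tangent slope \<open>c\<close> at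
  each element bounds all chain sums by one constant, whatever the length. Duality multiplies this
  constant by \<open>\<alpha>\<close>, and the subtracted part contributes at most \<open>c\<close>,
  as the total weight is at most 1.\<close>

lemma product_step:
  fixes v :: "'b \<Rightarrow> real" and w :: "'a \<Rightarrow> real"
  assumes P: "poset_on P le1" "finite P" and Q: "poset_on Q le2" "finite Q"
    and f: "sym_unimodal f"
    and v: "\<And>S h. S \<subseteq> Q \<Longrightarrow> height_le le2 S h \<Longrightarrow> sum v S \<le> window f h 0"
    and \<alpha>: "0 < \<alpha>" "\<alpha> \<le> 1"
    and w: "\<And>x. x \<in> P \<Longrightarrow> 0 \<le> w x" "sum w P \<le> 1"
    and antichain: "\<And>A. A \<subseteq> P \<Longrightarrow> (\<And>x y. x \<in> A \<Longrightarrow> y \<in> A \<Longrightarrow> le1 x y \<Longrightarrow> x = y) \<Longrightarrow> sum w A \<le> \<alpha>"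
    and T: "T \<subseteq> P \<times> Q" "height_le (prod_le le1 le2) T m"
  shows "(\<Sum>u\<in>T. w (fst u) * v (snd u)) \<le> window (nu_conv \<alpha> f) m 0"
proof -
  define g where "g x = (\<Sum>z\<in>{z \<in> Q. (x, z) \<in> T}. v z)" for x
  define k where "k = nu_star_k \<alpha>"
  define c where "c = window f m (int k)"
  have "c \<ge> 0" by (simp add: c_def window_nonneg[OF f])
  have slices: "sum g C \<le> spread f (card C) m"
    if "C \<subseteq> P" "Complete_Partial_Order.chain le1 C" for C
  proof -
    have fin: "finite C" using that(1) P(2) finite_subset by blast
    have "sum g C = (\<Sum>u\<in>Sigma C (\<lambda>x. {z \<in> Q. (x, z) \<in> T}). v (snd u))"
      unfolding g_def using fin Q(2) by (subst sum.Sigma) (auto simp: case_prod_beta)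
    also have "\<dots> \<le> spread f (card C) m"
    proof (rule sum_slices_le[OF P(1) Q(1) sym_unimodalD(2)[OF f] v])
      show "height_le (prod_le le1 le2) (SIGMA x:C. {z \<in> Q. (x, z) \<in> T}) m"
        by (rule height_le_subset[OF T(2)]) auto
    qed (use that fin Q in auto)
    finally show ?thesis .
  qed
  \<comment> \<open>Duality is for nonnegative functions; on a chain, the positive part merely
    selects the subchain \<open>C'\<close>.\<close>
  have "(\<Sum>x\<in>P. w x * max 0 (g x - c)) \<le> \<alpha> * (spread f k m - c * real k)"
  proof (rule antichain_chain_duality[OF P(2,1) antichain])
    fix C assume C: "C \<subseteq> P" "Complete_Partial_Order.chain le1 C"
    define C' where "C' = {x \<in> C. c < g x}"
    have fin: "finite C" using C(1) P(2) finite_subset by blast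
    have "(\<Sum>x\<in>C. max 0 (g x - c)) = (\<Sum>x\<in>C'. g x - c)"
      unfolding C'_def sum.inter_filter[OF fin] by (intro sum.cong) auto
    also have "\<dots> = sum g C' - c * real (card C')" by (simp add: sum_subtractf)
    also have "sum g C' \<le> spread f (card C') m"
      using C by (intro slices) (auto simp: C'_def chain_def)
    also have "spread f (card C') m - c * real (card C') \<le> spread f k m - c * real k"
      unfolding c_def by (rule spread_tangent[OF f])
    finally show "(\<Sum>x\<in>C. max 0 (g x - c)) \<le> spread f k m - c * real k" by simp
  qed (use \<alpha> in auto)
  moreover have "(\<Sum>x\<in>P. w x * g x) \<le> (\<Sum>x\<in>P. w x * max 0 (g x - c) + c * w x)"
  proof (rule sum_mono)
    fix x assume "x \<in> P"
    then have "w x * g x \<le> w x * (max 0 (g x - c) + c)" using w by (intro mult_left_mono) auto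
    then show "w x * g x \<le> w x * max 0 (g x - c) + c * w x" by (simp add: algebra_simps)
  qed
  moreover have "c * sum w P \<le> c" using w(2) \<open>c \<ge> 0\<close> by (simp add: mult_left_le)
  moreover have "(\<Sum>u\<in>T. w (fst u) * v (snd u)) = (\<Sum>x\<in>P. w x * g x)"
  proof -
    have "(\<Sum>x\<in>P. w x * g x) = (\<Sum>u\<in>Sigma P (\<lambda>x. {z \<in> Q. (x, z) \<in> T}). w (fst u) * v (snd u))"
      unfolding g_def sum_distrib_left using P Q by (subst sum.Sigma) (auto simp: case_prod_beta)
    also have "Sigma P (\<lambda>x. {z \<in> Q. (x, z) \<in> T}) = T" using T(1) by auto
    finally show ?thesis by simp
  qed
  ultimately show ?thesis
    using window_nu_conv[OF f \<alpha>, of m]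
    by (simp add: sum.distrib sum_distrib_left[symmetric] c_def k_def)
qed

section \<open>Products of several weighted posets\<close>

definition tuple_le :: "('i \<Rightarrow> 'a \<Rightarrow> 'a \<Rightarrow> bool) \<Rightarrow> 'i set \<Rightarrow> ('i \<Rightarrow> 'a) \<Rightarrow> ('i \<Rightarrow> 'a) \<Rightarrow> bool" where
  "tuple_le le I u v \<longleftrightarrow> (\<forall>i\<in>I. le i (u i) (v i))"

lemma poset_on_tuple:
  assumes "\<And>i. i \<in> I \<Longrightarrow> poset_on (F i) (le i)"
  shows "poset_on (PiE I F) (tuple_le le I)"
proof (rule poset_onI)
  note le = poset_onD[OF assms]
  show "tuple_le le I u u" if "u \<in> PiE I F" for u
    using le(1) that by (auto simp: tuple_le_def PiE_mem)
  show "tuple_le le I u w" if "u \<in> PiE I F" "v \<in> PiE I F" "w \<in> PiE I F"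
    "tuple_le le I u v" "tuple_le le I v w" for u v w
    unfolding tuple_le_def
  proof
    fix i assume "i \<in> I"
    then show "le i (u i) (w i)" using that le(2)[of i "u i" "v i" "w i"]
      by (auto simp: tuple_le_def PiE_mem)
  qed
  show "u = v" if "u \<in> PiE I F" "v \<in> PiE I F" "tuple_le le I u v" "tuple_le le I v u" for u v
  proof (rule PiE_ext[OF that(1,2)])
    fix i assume "i \<in> I"
    then show "u i = v i" using that le(3)[of i "u i" "v i"]
      by (auto simp: tuple_le_def PiE_mem)
  qed
qed

text \<open>Induction on the number of factors, with the last one split off as the first component
  of a pair. The claim for every \<open>m\<close> is what \<open>product_step\<close> asks of the
  other factors.\<close>

lemma sum_tuples_le:
  fixes w :: "nat \<Rightarrow> 'a \<Rightarrow> real" and le :: "nat \<Rightarrow> 'a \<Rightarrow> 'a \<Rightarrow> bool"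
  assumes "\<And>i. i \<in> {1..n} \<Longrightarrow> poset_on (F i) (le i)"
    and "\<And>i. i \<in> {1..n} \<Longrightarrow> finite (F i)"
    and "\<And>i. i \<in> {1..n} \<Longrightarrow> 0 < \<alpha> i \<and> \<alpha> i \<le> 1"
    and "\<And>i x. i \<in> {1..n} \<Longrightarrow> x \<in> F i \<Longrightarrow> 0 \<le> w i x"
    and "\<And>i. i \<in> {1..n} \<Longrightarrow> sum (w i) (F i) \<le> 1"
    and "\<And>i A. i \<in> {1..n} \<Longrightarrow> A \<subseteq> F i \<Longrightarrow>
      (\<And>x y. x \<in> A \<Longrightarrow> y \<in> A \<Longrightarrow> le i x y \<Longrightarrow> x = y) \<Longrightarrow> sum (w i) A \<le> \<alpha> i"
    and "T \<subseteq> PiE {1..n} F" "height_le (tuple_le le {1..n}) T m"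
  shows "(\<Sum>u\<in>T. \<Prod>i=1..n. w i (u i)) \<le> window (walk \<alpha> n) m 0"
  using assms
proof (induction n arbitrary: T m)
  case 0
  show ?case
  proof (cases m)
    case 0
    have "T = {}"
    proof (rule height_le_0D)
      show "height_le (tuple_le le {1..0}) T 0" using "0.prems"(8) \<open>m = 0\<close> by simp
    qed (simp add: tuple_le_def)
    then show ?thesis by (simp add: window_def sum_nonneg)
  next
    case (Suc h)
    \<comment> \<open>Only the empty tuple is left. Its weight 1 is the mass of \<open>walk\<close>
      at 0, a place in every nonempty window at 0.\<close>
    have "T \<subseteq> {\<lambda>_. undefined}" using "0.prems"(7) by simp
    then have "real (card T) \<le> 1" using card_mono[of "{\<lambda>_. undefined}" T] by auto
    moreover have "window (walk \<alpha> 0) m 0 = 1"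
      using Suc by (simp add: window_def)
    ultimately show ?thesis by simp
  qed
next
  case (Suc n)
  define I where "I = {1..n}"
  have I: "{1..Suc n} = insert (Suc n) I" "Suc n \<notin> I" "finite I" by (auto simp: I_def)
  let ?\<phi> = "\<lambda>u. (u (Suc n), restrict u I)"
  define v where "v u = (\<Prod>i\<in>I. w i (u i))" for u
  have inj: "inj_on ?\<phi> (PiE {1..Suc n} F)"
  proof (rule inj_onI)
    fix u u' assume u: "u \<in> PiE {1..Suc n} F" "u' \<in> PiE {1..Suc n} F" "?\<phi> u = ?\<phi> u'"
    show "u = u'"
    proof (rule PiE_ext[OF u(1,2)])
      fix i assume "i \<in> {1..Suc n}"
      then consider "i = Suc n" | "i \<in> I" unfolding I(1) by blast
      then show "u i = u' i"
      proof cases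
        case 2
        then show ?thesis using u(3) by (metis restrict_apply' snd_conv)
      qed (use u(3) in simp)
    qed
  qed
  have T: "T \<subseteq> PiE {1..Suc n} F" by (rule Suc.prems(7))
  have "finite (PiE {1..Suc n} F)" using Suc.prems(2) by (intro finite_PiE) simp_all
  then have finT: "finite T" by (rule finite_subset[OF T])
  have injT: "inj_on ?\<phi> T" using inj T inj_on_subset by blast
  have "(\<Sum>u\<in>T. \<Prod>i=1..Suc n. w i (u i)) = (\<Sum>u\<in>T. w (Suc n) (u (Suc n)) * v (restrict u I))"
    unfolding I(1) using I(2,3) by (simp add: v_def)
  also have "\<dots> = (\<Sum>u\<in>?\<phi> ` T. w (Suc n) (fst u) * v (snd u))"
    by (simp add: sum.reindex[OF injT])
  also have "\<dots> \<le> window (nu_conv (\<alpha> (Suc n)) (walk \<alpha> n)) m 0"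
  proof (rule product_step)
    show "poset_on (F (Suc n)) (le (Suc n))" "finite (F (Suc n))"
      using Suc.prems(1,2) by auto
    show "poset_on (PiE I F) (tuple_le le I)"
      using Suc.prems(1) by (intro poset_on_tuple) (auto simp: I_def)
    show "finite (PiE I F)" using Suc.prems(2) by (intro finite_PiE) (auto simp: I_def)
    show "sym_unimodal (walk \<alpha> n)" using Suc.prems(3) by (intro sym_unimodal_walk) auto
    show "sum v S \<le> window (walk \<alpha> n) h 0" if "S \<subseteq> PiE I F" "height_le (tuple_le le I) S h" for S h
      unfolding v_def I_def
    proof (rule Suc.IH)
      show "S \<subseteq> PiE {1..n} F" "height_le (tuple_le le {1..n}) S h"
        using that by (simp_all add: I_def)
    qed (use Suc.prems(1-6) in auto)
    show "?\<phi> ` T \<subseteq> F (Suc n) \<times> PiE I F"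
      using T unfolding I(1) by (auto simp: PiE_mem)
    show "height_le (prod_le (le (Suc n)) (tuple_le le I)) (?\<phi> ` T) m"
      unfolding height_le_def
    proof (intro allI impI)
      fix C assume C: "C \<subseteq> ?\<phi> ` T" "finite C"
        "Complete_Partial_Order.chain (prod_le (le (Suc n)) (tuple_le le I)) C"
      define C' where "C' = {u \<in> T. ?\<phi> u \<in> C}"
      have img: "C = ?\<phi> ` C'" using C(1) by (auto simp: C'_def)
      \<comment> \<open>Comparability of images gives comparability of tuples, so the preimage of a
        chain is a chain, and it is at least as large.\<close>
      have "tuple_le le {1..Suc n} u u'"
        if "prod_le (le (Suc n)) (tuple_le le I) (?\<phi> u) (?\<phi> u')" for u u'
        using that unfolding I(1) prod_le_def tuple_le_def by simp
      then have "Complete_Partial_Order.chain (tuple_le le {1..Suc n}) C'"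
        using C(3) unfolding chain_def C'_def by blast
      then have "card C' \<le> m"
        using finT by (intro height_leD[OF Suc.prems(8)]) (auto simp: C'_def)
      then show "card C \<le> m"
        unfolding img using finT card_image_le[of C' ?\<phi>] by (simp add: C'_def)
    qed
  qed (use Suc.prems(3-6)[of "Suc n"] in auto)
  finally show ?case by simp
qed

section \<open>Distances near a line\<close>

lemma infdist_line_less:
  assumes "infdist x {t *\<^sub>R v + b | t. True} < s"
  shows "\<exists>a. norm (x - (a *\<^sub>R v + b)) < s"
proof -
  have "(INF y\<in>{t *\<^sub>R v + b | t. True}. dist x y) < s"
    using assms by (subst (asm) infdist_notempty) auto
  then obtain y where "y \<in> {t *\<^sub>R v + b | t. True}" "dist x y < s"
    by (subst (asm) cINF_less_iff) auto
  then show ?thesis by (auto simp: dist_norm)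
qed

text \<open>
  \<open>\<beta>\<close> accounts for the deviation from the line: it is \<open>0\<close> in a Hilbert space, where \<open>t\<close> is the
  orthogonal projection, and twice the width of the strip in general.
\<close>

definition line_coordinate :: "'s::real_normed_vector set \<Rightarrow> ('s \<Rightarrow> real) \<Rightarrow> real \<Rightarrow> real \<Rightarrow> bool" where
  "line_coordinate R t \<tau> \<beta> \<longleftrightarrow> 0 \<le> \<beta> \<and> \<tau> < 1 \<and>
     (\<forall>x\<in>R. \<forall>y\<in>R. \<tau> \<le> norm (x - y) \<longrightarrow> 1 / 2 + \<beta> \<le> \<bar>t y - t x\<bar>) \<and>
     (\<forall>(J::nat set) x y. finite J \<longrightarrow> x ` J \<subseteq> R \<longrightarrow> y ` J \<subseteq> R \<longrightarrow>
        (\<Sum>i\<in>J. t (y i) - t (x i) - \<beta>) \<le> norm (\<Sum>i\<in>J. y i - x i))"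

text \<open>Take for \<open>t\<close> the parameter of a line point within \<open>s\<close>.
  Differences of points of the strip deviate from multiples of \<open>v\<close> by at most
  \<open>2 * s\<close>, which fixes \<open>\<beta>\<close>. A norm of at least
  \<open>1 / 2 + 4 * s\<close> then leaves \<open>1 / 2 + \<beta>\<close> for \<open>t\<close>, and
  this threshold is below 1 exactly when \<open>s < 1 / 8\<close>.\<close>

lemma line_coordinate_normed:
  fixes v b :: "'s::real_normed_vector"
  assumes v: "norm v = 1" and s: "s < 1 / 8"
  shows "\<exists>t \<tau> \<beta>. line_coordinate {x. infdist x {a *\<^sub>R v + b | a. True} < s} t \<tau> \<beta>"
proof (cases "0 < s")
  case True
  define R where "R = {x. infdist x {a *\<^sub>R v + b | a. True} < s}"
  have "\<exists>a. norm (x - (a *\<^sub>R v + b)) < s" if "x \<in> R" for x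
    using infdist_line_less[of x v b s] that unfolding R_def by blast
  then obtain t where t: "\<And>x. x \<in> R \<Longrightarrow> norm (x - (t x *\<^sub>R v + b)) < s" by metis
  have dev: "norm ((y - x) - (t y - t x) *\<^sub>R v) \<le> 2 * s" if "x \<in> R" "y \<in> R" for x y
  proof -
    have eq: "(y - x) - (t y - t x) *\<^sub>R v = (y - (t y *\<^sub>R v + b)) - (x - (t x *\<^sub>R v + b))"
      by (simp add: algebra_simps)
    show ?thesis
      unfolding eq
      using norm_triangle_ineq4[of "y - (t y *\<^sub>R v + b)" "x - (t x *\<^sub>R v + b)"]
        t[OF that(1)] t[OF that(2)] by linarith
  qed
  have "line_coordinate R t (1 / 2 + 4 * s) (2 * s)"
    unfolding line_coordinate_def
  proof (intro conjI ballI allI impI)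
    fix x y assume xy: "x \<in> R" "y \<in> R" "1 / 2 + 4 * s \<le> norm (x - y)"
    have "norm (y - x) \<le> norm ((y - x) - (t y - t x) *\<^sub>R v) + norm ((t y - t x) *\<^sub>R v)"
      using norm_triangle_ineq[of "(y - x) - (t y - t x) *\<^sub>R v" "(t y - t x) *\<^sub>R v"] by simp
    also have "\<dots> \<le> 2 * s + \<bar>t y - t x\<bar>" using dev[OF xy(1,2)] v by simp
    finally show "1 / 2 + 2 * s \<le> \<bar>t y - t x\<bar>" using xy(3) by (simp add: norm_minus_commute)
  next
    fix J :: "nat set" and x y
    assume J: "finite J" "x ` J \<subseteq> R" "y ` J \<subseteq> R"
    have eq: "(\<Sum>i\<in>J. y i - x i) - (\<Sum>i\<in>J. t (y i) - t (x i)) *\<^sub>R v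
        = (\<Sum>i\<in>J. (y i - x i) - (t (y i) - t (x i)) *\<^sub>R v)"
      by (subst (3) sum_subtractf) (simp only: scaleR_sum_left)
    have "norm ((\<Sum>i\<in>J. y i - x i) - (\<Sum>i\<in>J. t (y i) - t (x i)) *\<^sub>R v) \<le> (\<Sum>i\<in>J. 2 * s)"
      unfolding eq using J dev by (intro sum_norm_le) auto
    moreover have "(\<Sum>i\<in>J. t (y i) - t (x i)) \<le> norm ((\<Sum>i\<in>J. t (y i) - t (x i)) *\<^sub>R v)"
      using v by simp
    moreover have "norm ((\<Sum>i\<in>J. t (y i) - t (x i)) *\<^sub>R v) \<le> norm (\<Sum>i\<in>J. y i - x i)
        + norm ((\<Sum>i\<in>J. y i - x i) - (\<Sum>i\<in>J. t (y i) - t (x i)) *\<^sub>R v)"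
      by (subst norm_minus_commute[of "\<Sum>i\<in>J. y i - x i"]) (rule norm_triangle_sub)
    ultimately show "(\<Sum>i\<in>J. t (y i) - t (x i) - 2 * s) \<le> norm (\<Sum>i\<in>J. y i - x i)"
      unfolding sum_subtractf[of "\<lambda>i. t (y i) - t (x i)" "\<lambda>_. 2 * s"] by linarith
  qed (use True s in auto)
  then show ?thesis unfolding R_def by blast
next
  case False
  then have "{x. infdist x {a *\<^sub>R v + b | a. True} < s} = {}"
    using infdist_nonneg[of _ "{a *\<^sub>R v + b | a. True}"] by (auto simp: not_less intro: order_trans)
  then have "line_coordinate {x. infdist x {a *\<^sub>R v + b | a. True} < s} (\<lambda>_. 0) 0 0"
    by (auto simp: line_coordinate_def)
  then show ?thesis by blast
qed

text \<open>The components of two points orthogonal to \<open>v\<close> differ by at most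
  \<open>2 * s\<close>. By Pythagoras, a norm of at least
  \<open>sqrt (1 / 4 + 4 * s\<^sup>2)\<close> leaves \<open>1 / 2\<close> along \<open>v\<close>,
  and for \<open>0 < s < sqrt 3 / 4\<close> this threshold is below 1. The coordinate differences
  are linear and at most the norm, so \<open>\<beta>\<close> can be 0.\<close>

lemma line_coordinate_hilbert:
  fixes v b :: "'s::real_normed_vector"
  assumes v: "norm v = 1" and s: "s < sqrt 3 / 4" and H: "hilbert_space TYPE('s)"
  shows "\<exists>t \<tau> \<beta>. line_coordinate {x. infdist x {a *\<^sub>R v + b | a. True} < s} t \<tau> \<beta>"
proof (cases "0 < s")
  case True
  define R where "R = {x. infdist x {a *\<^sub>R v + b | a. True} < s}"
  obtain ip :: "'s \<Rightarrow> 's \<Rightarrow> real" where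
    comm: "\<And>x y. ip x y = ip y x" and
    add: "\<And>x y z. ip (x + y) z = ip x z + ip y z" and
    scale: "\<And>r x y. ip (r *\<^sub>R x) y = r * ip x y" and
    sq: "\<And>x. ip x x = (norm x)\<^sup>2"
    using H unfolding hilbert_space_def by blast
  have addr: "ip z (x + y) = ip z x + ip z y" for x y z
    using add[of x y z] by (simp only: comm[of z])
  have scaler: "ip x (r *\<^sub>R y) = r * ip x y" for r x y
    using scale[of r y x] by (simp only: comm[of x])
  have zero: "ip 0 z = 0" for z using scale[of 0 0 z] by simp
  have diff: "ip (x - y) z = ip x z - ip y z" for x y z
    using add[of "x - y" y z] by simp
  have sums: "ip (\<Sum>i\<in>J. h i) z = (\<Sum>i\<in>J. ip (h i) z)" if "finite J" for J :: "nat set" and h z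
    using that by (induction J rule: finite_induct) (simp_all add: zero add)
  have pythagoras: "(norm (w + a *\<^sub>R v))\<^sup>2 = (norm w)\<^sup>2 + a\<^sup>2" if "ip w v = 0" for w a
  proof -
    have "(norm (w + a *\<^sub>R v))\<^sup>2 = ip w w + 2 * a * ip w v + a * a * ip v v"
      unfolding sq[symmetric] add scale addr scaler comm[of v w]
      by (simp add: algebra_simps)
    then show ?thesis using that v sq[of v] sq[of w] by (simp add: power2_eq_square)
  qed
  define t where "t x = ip (x - b) v" for x
  define p where "p x = x - b - t x *\<^sub>R v" for x
  have orth: "ip (p x) v = 0" for x
    using v by (simp add: p_def diff[of "x - b"] scale sq t_def)
  have t_diff: "t y - t x = ip (y - x) v" for x y
    using diff[of "y - b" "x - b" v] by (simp add: t_def)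
  \<comment> \<open>The orthogonal projection is the nearest point of the line, so it inherits the
    bound \<open>s\<close>.\<close>
  have dev: "norm (p x) < s" if x: "x \<in> R" for x
  proof -
    obtain a where a: "norm (x - (a *\<^sub>R v + b)) < s"
      using infdist_line_less[of x v b s] x unfolding R_def by blast
    have "x - (a *\<^sub>R v + b) = p x + (t x - a) *\<^sub>R v" by (simp add: p_def algebra_simps)
    then have "(norm (p x))\<^sup>2 \<le> (norm (x - (a *\<^sub>R v + b)))\<^sup>2"
      using pythagoras[OF orth] by simp
    then have "norm (p x) \<le> norm (x - (a *\<^sub>R v + b))" by (rule power2_le_imp_le) simp
    then show ?thesis using a by simp
  qed
  define \<tau> where "\<tau> = sqrt (1 / 4 + 4 * s\<^sup>2)"
  have "s\<^sup>2 < (sqrt 3 / 4)\<^sup>2" using s True by (intro power_strict_mono) auto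
  then have "\<tau> < 1" unfolding \<tau>_def by (simp add: power_divide)
  have "line_coordinate R t \<tau> 0"
    unfolding line_coordinate_def
  proof (intro conjI ballI allI impI)
    fix x y assume xy: "x \<in> R" "y \<in> R" "\<tau> \<le> norm (x - y)"
    have "ip (p y - p x) v = 0" by (simp add: diff orth)
    moreover have "y - x = (p y - p x) + (t y - t x) *\<^sub>R v" by (simp add: p_def algebra_simps)
    ultimately have "(norm (y - x))\<^sup>2 = (norm (p y - p x))\<^sup>2 + (t y - t x)\<^sup>2"
      by (simp only: pythagoras)
    moreover have "norm (p y - p x) \<le> 2 * s"
      using norm_triangle_ineq4[of "p y" "p x"] dev[OF xy(1)] dev[OF xy(2)] by simp
    then have "(norm (p y - p x))\<^sup>2 \<le> (2 * s)\<^sup>2" by (intro power_mono) auto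
    moreover have "\<tau>\<^sup>2 \<le> (norm (y - x))\<^sup>2"
      using xy(3) by (intro power_mono) (auto simp: \<tau>_def norm_minus_commute)
    moreover have "\<tau>\<^sup>2 = 1 / 4 + 4 * s\<^sup>2" by (simp add: \<tau>_def)
    ultimately have "(1 / 2)\<^sup>2 \<le> (t y - t x)\<^sup>2" by (simp add: power_mult_distrib power2_eq_square)
    then show "1 / 2 + 0 \<le> \<bar>t y - t x\<bar>"
      using abs_le_square_iff[of "1 / 2" "t y - t x"] by simp
  next
    fix J :: "nat set" and x y :: "nat \<Rightarrow> 's"
    assume J: "finite J"
    define d where "d = (\<Sum>i\<in>J. y i - x i)"
    \<comment> \<open>Pythagoras for the projection of \<open>d\<close> yields Cauchy--Schwarz
      against the unit vector \<open>v\<close>.\<close>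
    have "ip (d - ip d v *\<^sub>R v) v = 0" using v by (simp add: diff scale sq)
    from pythagoras[OF this, of "ip d v"] have "(ip d v)\<^sup>2 \<le> (norm d)\<^sup>2" by simp
    then have "ip d v \<le> norm d" by (rule power2_le_imp_le) simp
    then show "(\<Sum>i\<in>J. t (y i) - t (x i) - 0) \<le> norm (\<Sum>i\<in>J. y i - x i)"
      by (simp add: t_diff d_def sums[OF J])
  qed (use \<open>\<tau> < 1\<close> in auto)
  then show ?thesis unfolding R_def by blast
next
  case False
  then have "{x. infdist x {a *\<^sub>R v + b | a. True} < s} = {}"
    using infdist_nonneg[of _ "{a *\<^sub>R v + b | a. True}"] by (auto simp: not_less intro: order_trans)
  then have "line_coordinate {x. infdist x {a *\<^sub>R v + b | a. True} < s} (\<lambda>_. 0) 0 0"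
    by (auto simp: line_coordinate_def)
  then show ?thesis by blast
qed

text \<open>The order is on indices rather than points, so that cells with coinciding centres stay
  distinct. The threshold \<open>\<tau>\<close> will be slightly below 1 to leave room for the cell
  radius.\<close>

definition far_le :: "('s::real_normed_vector \<Rightarrow> real) \<Rightarrow> real \<Rightarrow> (nat \<Rightarrow> 's) \<Rightarrow> nat \<Rightarrow> nat \<Rightarrow> bool" where
  "far_le t \<tau> d j j' \<longleftrightarrow> j = j' \<or> t (d j) < t (d j') \<and> \<tau> \<le> norm (d j - d j')"

text \<open>After deduction of \<open>\<beta>\<close> each increment still contributes
  \<open>1 / 2\<close>, so two of them reach norm 1.\<close>

lemma line_coordinate_sum_ge:
  assumes "line_coordinate R t \<tau>0 \<beta>" "\<tau>0 \<le> \<tau>" "2 \<le> card J" "x ` J \<subseteq> R" "y ` J \<subseteq> R"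
    and "\<And>i. i \<in> J \<Longrightarrow> t (x i) < t (y i) \<and> \<tau> \<le> norm (x i - y i)"
  shows "1 \<le> norm (\<Sum>i\<in>(J::nat set). y i - x i)"
proof -
  have J: "finite J" using assms(3) by (intro card_ge_0_finite) simp
  have "1 / 2 \<le> t (y i) - t (x i) - \<beta>" if "i \<in> J" for i
  proof -
    have "x i \<in> R" "y i \<in> R" "\<tau>0 \<le> norm (x i - y i)" using that assms(2,4-6) by fastforce+
    then have "1 / 2 + \<beta> \<le> \<bar>t (y i) - t (x i)\<bar>"
      using assms(1) unfolding line_coordinate_def by blast
    then show ?thesis using assms(6)[OF that] by simp
  qed
  then have "(\<Sum>i\<in>J. 1 / 2) \<le> (\<Sum>i\<in>J. t (y i) - t (x i) - \<beta>)" by (rule sum_mono)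
  also have "\<dots> \<le> norm (\<Sum>i\<in>J. y i - x i)"
    using assms(1,4,5) J unfolding line_coordinate_def by blast
  finally show ?thesis using assms(3) by simp
qed

text \<open>Transitivity is the case of two increments, which add up to norm at least 1 and hence at
  least \<open>\<tau>\<close>.\<close>

lemma poset_on_far_le:
  assumes "line_coordinate R t \<tau>0 \<beta>" "\<tau>0 \<le> \<tau>" "\<tau> \<le> 1" "d ` A \<subseteq> R"
  shows "poset_on A (far_le t \<tau> d)"
proof (rule poset_onI)
  fix i j k assume A: "i \<in> A" "j \<in> A" "k \<in> A" and le: "far_le t \<tau> d i j" "far_le t \<tau> d j k"
  show "far_le t \<tau> d i k"
  proof (cases "i = j \<or> j = k")
    case False
    then have lt: "t (d i) < t (d j) \<and> \<tau> \<le> norm (d i - d j)" "t (d j) < t (d k) \<and> \<tau> \<le> norm (d j - d k)"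
      using le by (auto simp: far_le_def)
    define x y where "x l = (if l = 0 then d i else d j)" and "y l = (if l = 0 then d j else d k)"
      for l :: nat
    have "1 \<le> norm (\<Sum>l\<in>{0, 1}. y l - x l)"
      using A assms(4) lt by (intro line_coordinate_sum_ge[OF assms(1,2)]) (auto simp: x_def y_def)
    then have "1 \<le> norm (d i - d k)" by (simp add: x_def y_def norm_minus_commute)
    then show ?thesis using lt assms(3) by (auto simp: far_le_def)
  qed (use le in auto)
qed (auto simp: far_le_def)

text \<open>Only coordinates where the tuples differ contribute. A single one is far by the
  definition of the order; two or more reach norm 1.\<close>

lemma norm_tuple_diff_ge:
  assumes t: "line_coordinate R t \<tau>0 \<beta>" "\<tau>0 \<le> \<tau>" "\<tau> \<le> 1"
    and d: "\<And>i. i \<in> I \<Longrightarrow> range (d i) \<subseteq> R" and I: "finite (I::nat set)"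
    and u: "u \<in> PiE I F" "u' \<in> PiE I F" "tuple_le (\<lambda>i. far_le t \<tau> (d i)) I u u'" "u \<noteq> u'"
  shows "\<tau> \<le> norm (\<Sum>i\<in>I. d i (u' i) - d i (u i))"
proof -
  define J where "J = {i \<in> I. u i \<noteq> u' i}"
  have lt: "t (d i (u i)) < t (d i (u' i)) \<and> \<tau> \<le> norm (d i (u i) - d i (u' i))" if "i \<in> J" for i
    using u(3) that by (auto simp: J_def tuple_le_def far_le_def)
  have eq: "(\<Sum>i\<in>I. d i (u' i) - d i (u i)) = (\<Sum>i\<in>J. d i (u' i) - d i (u i))"
    using I by (intro sum.mono_neutral_right) (auto simp: J_def)
  have J: "finite J" using I by (simp add: J_def)
  have "J \<noteq> {}" using PiE_ext[OF u(1,2)] u(4) by (auto simp: J_def)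
  then have "0 < card J" using J by (simp add: card_gt_0_iff)
  then consider "card J = 1" | "2 \<le> card J" by linarith
  then show ?thesis
  proof cases
    case 1
    then obtain i where "J = {i}" using card_1_singletonE by blast
    then show ?thesis using lt[of i] by (simp add: eq norm_minus_commute)
  next
    case 2
    then have "1 \<le> norm (\<Sum>i\<in>J. d i (u' i) - d i (u i))"
      using d lt by (intro line_coordinate_sum_ge[OF t(1,2)]) (auto simp: J_def)
    then show ?thesis using eq t(3) by simp
  qed
qed

text \<open>Moving \<open>a\<close> away from \<open>y\<close> by \<open>3 / 4 * \<eta>\<close>
  stays in the open ball, hence in \<open>S\<close>, and lengthens the distance by that
  amount.\<close>

lemma dist_le_of_ball_subset:
  fixes a :: "'s::real_normed_vector"
  assumes "ball a \<eta> \<subseteq> S" "y \<in> S" "a \<noteq> y" "0 < \<eta>" "bounded S" "diameter S \<le> 1"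
  shows "dist a y \<le> 1 - 3 / 4 * \<eta>"
proof -
  define e where "e = (3 / 4 * \<eta>) / norm (a - y)"
  have e: "0 < e" "e * norm (a - y) = 3 / 4 * \<eta>" using assms(3,4) by (simp_all add: e_def)
  have "a + e *\<^sub>R (a - y) \<in> ball a \<eta>" using e assms(4) by (simp add: dist_norm)
  then have "dist (a + e *\<^sub>R (a - y)) y \<le> diameter S"
    using assms by (intro diameter_bounded_bound) auto
  moreover have eq: "a + e *\<^sub>R (a - y) - y = (1 + e) *\<^sub>R (a - y)" by (simp add: algebra_simps)
  have "dist (a + e *\<^sub>R (a - y)) y = norm (a - y) + e * norm (a - y)"
    unfolding dist_norm eq norm_scaleR using e(1) by (simp add: distrib_right)
  ultimately show ?thesis using assms(6) e(2) by (simp add: dist_norm)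
qed

section \<open>Discretisation\<close>

context prob_space
begin

text \<open>
  The cells of radius \<open>\<delta>\<close> around the points \<open>d i j\<close> reduce the claim to a weighted product
  of finite posets, in which the cells meeting the \<open>\<eta>\<close>-interior of \<open>S\<close> form an antichain. The event
  \<open>G\<close> is measurable even if the sum is not.
\<close>

lemma sum_in_interior_le:
  fixes X :: "nat \<Rightarrow> 'a \<Rightarrow> 's::real_normed_vector"
  assumes n: "1 \<le> n" and indep: "indep_vars (\<lambda>_. borel) X {1..n}"
    and \<alpha>: "\<And>i. i \<in> {1..n} \<Longrightarrow> 0 < \<alpha> i \<and> \<alpha> i \<le> 1"
    and conc: "\<And>i U. i \<in> {1..n} \<Longrightarrow> open U \<Longrightarrow> bounded U \<Longrightarrow> diameter U \<le> 1 \<Longrightarrow>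
      prob (X i -` U \<inter> space M) \<le> \<alpha> i"
    and t: "line_coordinate R t \<tau>0 \<beta>"
    and cover: "\<And>i \<delta>. i \<in> {1..n} \<Longrightarrow> 0 < \<delta> \<Longrightarrow>
      \<exists>d::nat \<Rightarrow> 's. range d \<subseteq> R \<and> (AE \<omega> in M. \<exists>j. X i \<omega> \<in> ball (d j) \<delta>)"
    and S: "bounded S" "diameter S \<le> 1"
    and \<eta>: "0 < \<eta>" "\<eta> \<le> 1" and \<epsilon>: "0 < \<epsilon>"
  shows "\<exists>G\<in>events. {\<omega> \<in> space M. ball (\<Sum>i=1..n. X i \<omega>) \<eta> \<subseteq> S} \<subseteq> G \<and>
    prob G \<le> window (walk \<alpha> n) 1 0 + \<epsilon>"
proof -
  \<comment> \<open>Since \<open>1 - \<tau> \<le> \<eta> / 2\<close>, the margin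
    \<open>3 / 4 * \<eta>\<close> of the interior exceeds \<open>1 - \<tau>\<close> by at least
    \<open>\<eta> / 4\<close>. For the radius, \<open>2 * \<delta> \<le> 1 - \<tau>\<close> keeps
    unions of antichain cells within diameter 1, and \<open>n * \<delta> \<le> \<eta> / 16\<close>
    keeps the displacements in two sums within \<open>\<eta> / 8\<close>.\<close>
  define \<tau> where "\<tau> = max \<tau>0 (1 - \<eta> / 2)"
  define \<delta> where "\<delta> = min ((1 - \<tau>) / 2) (\<eta> / (16 * real n))"
  have \<tau>: "\<tau>0 \<le> \<tau>" "1 - \<eta> / 2 \<le> \<tau>" "\<tau> < 1" "0 < \<tau>"
    using t \<eta> by (auto simp: \<tau>_def line_coordinate_def)
  have "0 < \<delta>" "2 * \<delta> \<le> 1 - \<tau>" using \<tau> \<eta> n by (auto simp: \<delta>_def min_def)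
  have n\<delta>: "real n * \<delta> \<le> \<eta> / 16"
  proof -
    have "real n * \<delta> \<le> real n * (\<eta> / (16 * real n))"
      unfolding \<delta>_def by (intro mult_left_mono) auto
    then show ?thesis using n by simp
  qed
  have meas: "X i \<in> borel_measurable M" if "i \<in> {1..n}" for i
    using indep that by (auto simp: indep_vars_def)
  have "\<forall>i\<in>{1..n}. \<exists>d::nat \<Rightarrow> 's. range d \<subseteq> R \<and> (AE \<omega> in M. \<exists>j. X i \<omega> \<in> ball (d j) \<delta>)"
    using cover \<open>0 < \<delta>\<close> by blast
  then obtain d :: "nat \<Rightarrow> nat \<Rightarrow> 's" where
    d: "\<And>i. i \<in> {1..n} \<Longrightarrow> range (d i) \<subseteq> R"
       "\<And>i. i \<in> {1..n} \<Longrightarrow> AE \<omega> in M. \<exists>j. X i \<omega> \<in> ball (d i j) \<delta>"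
    by (metis (no_types))
  define cell where "cell i = disjointed (\<lambda>j. ball (d i j) \<delta>)" for i
  define Ev where "Ev i j = X i -` cell i j \<inter> space M" for i j
  have cell_ball: "cell i j \<subseteq> ball (d i j) \<delta>" for i j
    unfolding cell_def by (rule disjointed_subset)
  have cell_borel: "cell i j \<in> sets borel" for i j
    unfolding cell_def disjointed_def by auto
  have Ev: "Ev i j \<in> events" if "i \<in> {1..n}" for i j
    unfolding Ev_def using meas[OF that] cell_borel by (rule measurable_sets)
  have Ev_disj: "disjoint_family (Ev i)" for i
    using disjoint_family_disjointed[of "\<lambda>j. ball (d i j) \<delta>"]
    unfolding Ev_def cell_def disjoint_family_on_def by blast
  \<comment> \<open>The combinatorial bound is for finite posets, so each factor is cut down to
    finitely many cells, at a loss of at most \<open>\<epsilon> / n\<close>.\<close>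
  have "\<exists>N. 1 - \<epsilon> / real n \<le> prob (\<Union>j\<in>{..<N}. Ev i j)" if i: "i \<in> {1..n}" for i
  proof -
    have "incseq (\<lambda>N. \<Union>j\<in>{..<N}. Ev i j)" unfolding incseq_def by (intro allI impI UN_mono) auto
    then have "(\<lambda>N. prob (\<Union>j\<in>{..<N}. Ev i j)) \<longlonglongrightarrow> prob (\<Union>N. \<Union>j\<in>{..<N}. Ev i j)"
      using Ev[OF i] by (intro finite_Lim_measure_incseq) auto
    moreover have "prob (\<Union>N. \<Union>j\<in>{..<N}. Ev i j) = 1"
    proof (subst prob_eq_1)
      show "(\<Union>N. \<Union>j\<in>{..<N}. Ev i j) \<in> events" using Ev[OF i] by auto
      show "AE \<omega> in M. \<omega> \<in> (\<Union>N. \<Union>j\<in>{..<N}. Ev i j)"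
        using d(2)[OF i] AE_space
      proof eventually_elim
        case (elim \<omega>)
        then have "X i \<omega> \<in> (\<Union>j. cell i j)" unfolding cell_def UN_disjointed_eq by blast
        then show ?case using elim(2) by (auto simp: Ev_def)
      qed
    qed
    moreover have "1 - \<epsilon> / real n < 1" using \<epsilon> n by simp
    ultimately have "eventually (\<lambda>N. 1 - \<epsilon> / real n < prob (\<Union>j\<in>{..<N}. Ev i j)) sequentially"
      by (intro order_tendstoD) auto
    then show ?thesis using eventually_happens[of _ sequentially] by (force intro: less_imp_le)
  qed
  then obtain K where K: "\<And>i. i \<in> {1..n} \<Longrightarrow> 1 - \<epsilon> / real n \<le> prob (\<Union>j\<in>{..<K i}. Ev i j)" by metis
  define F where "F i = {..<K i}" for i
  define Bad where "Bad i = space M - (\<Union>j\<in>F i. Ev i j)" for i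
  define T where "T = {u \<in> PiE {1..n} F. \<exists>\<omega>\<in>space M. (\<forall>i\<in>{1..n}. X i \<omega> \<in> cell i (u i)) \<and>
    ball (\<Sum>i=1..n. X i \<omega>) \<eta> \<subseteq> S}"
  define box where "box u = (\<Inter>i\<in>{1..n}. X i -` cell i (u i) \<inter> space M)" for u
  define G where "G = (\<Union>u\<in>T. box u) \<union> (\<Union>i\<in>{1..n}. Bad i)"
  have finT: "finite T"
    unfolding T_def by (intro finite_subset[OF _ finite_PiE[of "{1..n}" F]]) (auto simp: F_def)
  have box: "box u \<in> events" for u
    unfolding box_def using n meas cell_borel by (intro sets.finite_INT measurable_sets) auto
  have Bad: "Bad i \<in> events" "prob (Bad i) \<le> \<epsilon> / real n" if "i \<in> {1..n}" for i
  proof -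
    have "(\<Union>j\<in>F i. Ev i j) \<in> events" using Ev[OF that] by (auto simp: F_def)
    then show "Bad i \<in> events" "prob (Bad i) \<le> \<epsilon> / real n"
      using K[OF that] by (auto simp: Bad_def prob_compl F_def)
  qed
  have "height_le (tuple_le (\<lambda>i. far_le t \<tau> (d i)) {1..n}) T 1"
    unfolding height_le_def
  proof (intro allI impI)
    fix C assume C: "C \<subseteq> T" "finite C"
      "Complete_Partial_Order.chain (tuple_le (\<lambda>i. far_le t \<tau> (d i)) {1..n}) C"
    \<comment> \<open>Comparable distinct tuples have sums of centres at distance at least
      \<open>\<tau>\<close>, whereas two points of the \<open>\<eta>\<close>-interior are at most
      \<open>1 - 3 / 4 * \<eta>\<close> apart and the displacements add at most
      \<open>\<eta> / 8\<close>.\<close>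
    have *: "u = u'" if u: "u \<in> T" "u' \<in> T" "tuple_le (\<lambda>i. far_le t \<tau> (d i)) {1..n} u u'" for u u'
    proof (rule ccontr)
      assume "u \<noteq> u'"
      obtain \<omega> where \<omega>: "\<And>i. i \<in> {1..n} \<Longrightarrow> X i \<omega> \<in> cell i (u i)" "ball (\<Sum>i=1..n. X i \<omega>) \<eta> \<subseteq> S"
        using u(1) unfolding T_def by blast
      obtain \<omega>' where \<omega>': "\<And>i. i \<in> {1..n} \<Longrightarrow> X i \<omega>' \<in> cell i (u' i)" "ball (\<Sum>i=1..n. X i \<omega>') \<eta> \<subseteq> S"
        using u(2) unfolding T_def by blast
      define x x' where "x = (\<Sum>i=1..n. X i \<omega>)" and "x' = (\<Sum>i=1..n. X i \<omega>')"
      have "\<tau> \<le> norm (\<Sum>i\<in>{1..n}. d i (u' i) - d i (u i))"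
        using u \<open>u \<noteq> u'\<close> \<tau>(1,3) d(1)
        by (intro norm_tuple_diff_ge[OF t, of \<tau> "{1..n}" d u F u']) (auto simp: T_def)
      also have "(\<Sum>i\<in>{1..n}. d i (u' i) - d i (u i))
          = (\<Sum>i=1..n. d i (u' i) - X i \<omega>') + (x' - x) + (\<Sum>i=1..n. X i \<omega> - d i (u i))"
        by (simp add: x_def x'_def sum_subtractf)
      also have "norm \<dots> \<le> norm (\<Sum>i=1..n. d i (u' i) - X i \<omega>') + norm (x' - x)
          + norm (\<Sum>i=1..n. X i \<omega> - d i (u i))"
        by (intro norm_triangle_le add_mono norm_triangle_ineq order_refl)
      also have "norm (\<Sum>i=1..n. d i (u' i) - X i \<omega>') \<le> (\<Sum>i=1..n. \<delta>)"
      proof (intro sum_norm_le)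
        fix i assume i: "i \<in> {1..n}"
        show "norm (d i (u' i) - X i \<omega>') \<le> \<delta>"
          using \<omega>'(1)[OF i] cell_ball[of i "u' i"] by (auto simp: dist_norm)
      qed
      also have "norm (\<Sum>i=1..n. X i \<omega> - d i (u i)) \<le> (\<Sum>i=1..n. \<delta>)"
      proof (intro sum_norm_le)
        fix i assume i: "i \<in> {1..n}"
        show "norm (X i \<omega> - d i (u i)) \<le> \<delta>"
          using \<omega>(1)[OF i] cell_ball[of i "u i"] by (auto simp: dist_norm norm_minus_commute)
      qed
      finally have "\<tau> \<le> norm (x' - x) + \<eta> / 8" using n\<delta> by (simp add: algebra_simps)
      moreover have "norm (x' - x) \<le> 1 - 3 / 4 * \<eta>"
      proof (cases "x' = x")
        case False
        have "x \<in> S" using \<omega>(2) \<eta> unfolding x_def[symmetric] by auto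
        then show ?thesis
          using dist_le_of_ball_subset[of x' \<eta> S x] \<omega>'(2) \<eta> S False
          unfolding x'_def[symmetric] by (simp add: dist_norm)
      qed (use \<eta> in simp)
      ultimately show False using \<tau>(2) \<eta>(1) by simp
    qed
    have "u = u'" if "u \<in> C" "u' \<in> C" for u u'
      using *[of u u'] *[of u' u] C(1,3) that unfolding chain_def by blast
    then show "card C \<le> 1" using C(2) by (simp add: card_le_Suc0_iff_eq)
  qed
  then have "(\<Sum>u\<in>T. \<Prod>i=1..n. prob (Ev i (u i))) \<le> window (walk \<alpha> n) 1 0"
  proof (rule sum_tuples_le[rotated -1])
    show "T \<subseteq> PiE {1..n} F" by (auto simp: T_def)
    fix i assume i: "i \<in> {1..n}"
    show "poset_on (F i) (far_le t \<tau> (d i))"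
      using d(1)[OF i] \<tau> by (intro poset_on_far_le[OF t]) auto
    show "finite (F i)" by (simp add: F_def)
    show "0 < \<alpha> i \<and> \<alpha> i \<le> 1" by (rule \<alpha>[OF i])
    have sum_eq: "(\<Sum>j\<in>A. prob (Ev i j)) = prob (\<Union>j\<in>A. Ev i j)" if "A \<subseteq> F i" for A
    proof (rule finite_measure_finite_Union[symmetric])
      show "finite A" using that finite_subset by (auto simp: F_def)
      show "disjoint_family_on (Ev i) A" using Ev_disj[of i] by (auto simp: disjoint_family_on_def)
    qed (use Ev[OF i] in auto)
    show "(\<Sum>j\<in>F i. prob (Ev i j)) \<le> 1" by (simp add: sum_eq)
    show "0 \<le> prob (Ev i j)" for j by simp
    fix A assume A: "A \<subseteq> F i" "\<And>x y. x \<in> A \<Longrightarrow> y \<in> A \<Longrightarrow> far_le t \<tau> (d i) x y \<Longrightarrow> x = y"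
    \<comment> \<open>Incomparable centres are at most \<open>\<tau>\<close> apart, so this open set
      around the cells of \<open>A\<close> has diameter at most
      \<open>\<tau> + 2 * \<delta> \<le> 1\<close> and the concentration bound applies to
      it.\<close>
    define U where "U = (\<Union>j\<in>A. ball (d i j) \<delta>)"
    have "dist (d i j) (d i k) \<le> \<tau>" if jk: "j \<in> A" "k \<in> A" for j k
    proof (rule ccontr)
      assume "\<not> dist (d i j) (d i k) \<le> \<tau>"
      then have far: "\<tau> \<le> norm (d i j - d i k)" "j \<noteq> k" using \<tau>(4) by (auto simp: dist_norm)
      have "d i j \<in> R" "d i k \<in> R" "\<tau>0 \<le> norm (d i j - d i k)"
        using d(1)[OF i] far \<tau>(1) by auto
      then have "0 \<le> \<beta>" "1 / 2 + \<beta> \<le> \<bar>t (d i k) - t (d i j)\<bar>"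
        using t unfolding line_coordinate_def by blast+
      then have "t (d i j) \<noteq> t (d i k)" by auto
      then have "far_le t \<tau> (d i) j k \<or> far_le t \<tau> (d i) k j"
        using far by (auto simp: far_le_def norm_minus_commute)
      then show False using A(2)[of j k] A(2)[of k j] jk far(2) by auto
    qed
    note dist_le = this
    have U: "open U" "bounded U"
      using A(1) by (auto simp: U_def F_def intro: finite_subset)
    have "diameter U \<le> 1"
    proof (rule diameter_le)
      fix x y assume "x \<in> U" "y \<in> U"
      then obtain j k where jk: "j \<in> A" "x \<in> ball (d i j) \<delta>" "k \<in> A" "y \<in> ball (d i k) \<delta>"
        by (auto simp: U_def)
      have "dist x y \<le> dist x (d i j) + dist (d i j) (d i k) + dist (d i k) y"
        using dist_triangle[of x y "d i j"] dist_triangle[of "d i j" y "d i k"] by linarith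
      also have "\<dots> \<le> \<delta> + \<tau> + \<delta>"
        using jk dist_le[of j k] by (intro add_mono) (auto simp: dist_commute)
      finally show "norm (x - y) \<le> 1" using \<open>2 * \<delta> \<le> 1 - \<tau>\<close> by (simp add: dist_norm)
    qed simp
    then have "prob (X i -` U \<inter> space M) \<le> \<alpha> i" using U conc[OF i] by blast
    moreover have "(\<Union>j\<in>A. Ev i j) \<subseteq> X i -` U \<inter> space M"
      using cell_ball unfolding Ev_def U_def by blast
    then have "prob (\<Union>j\<in>A. Ev i j) \<le> prob (X i -` U \<inter> space M)"
      using U(1) by (intro finite_measure_mono measurable_sets[OF meas[OF i]]) auto
    ultimately show "(\<Sum>j\<in>A. prob (Ev i j)) \<le> \<alpha> i" by (simp add: sum_eq[OF A(1)])
  qed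
  moreover have "prob (box u) = (\<Prod>i=1..n. prob (Ev i (u i)))" for u
    unfolding box_def Ev_def using n cell_borel by (intro indep_varsD_finite[OF indep]) auto
  ultimately have "(\<Sum>u\<in>T. prob (box u)) \<le> window (walk \<alpha> n) 1 0" by simp
  moreover have "prob (\<Union>u\<in>T. box u) \<le> (\<Sum>u\<in>T. prob (box u))"
    using finT box by (intro finite_measure_subadditive_finite) auto
  moreover have "prob (\<Union>i\<in>{1..n}. Bad i) \<le> (\<Sum>i\<in>{1..n}. prob (Bad i))"
    using Bad(1) by (intro finite_measure_subadditive_finite) auto
  moreover have "(\<Sum>i\<in>{1..n}. prob (Bad i)) \<le> (\<Sum>i\<in>{1..n}. \<epsilon> / real n)"
    by (intro sum_mono Bad(2))
  moreover have unions: "(\<Union>u\<in>T. box u) \<in> events" "(\<Union>i\<in>{1..n}. Bad i) \<in> events"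
    using finT box Bad(1) by (auto intro!: sets.finite_UN)
  then have "prob G \<le> prob (\<Union>u\<in>T. box u) + prob (\<Union>i\<in>{1..n}. Bad i)"
    unfolding G_def by (intro measure_Un_le)
  ultimately have "prob G \<le> window (walk \<alpha> n) 1 0 + \<epsilon>" using n by simp
  moreover have "G \<in> events"
    unfolding G_def using unions by (rule sets.Un)
  moreover have "{\<omega> \<in> space M. ball (\<Sum>i=1..n. X i \<omega>) \<eta> \<subseteq> S} \<subseteq> G"
  proof
    fix \<omega> assume \<omega>: "\<omega> \<in> {\<omega> \<in> space M. ball (\<Sum>i=1..n. X i \<omega>) \<eta> \<subseteq> S}"
    show "\<omega> \<in> G"
    proof (cases "\<exists>i\<in>{1..n}. \<omega> \<in> Bad i")
      case False
      then have "\<forall>i\<in>{1..n}. \<exists>j\<in>F i. X i \<omega> \<in> cell i j" using \<omega> by (auto simp: Bad_def Ev_def)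
      then obtain u where u: "\<And>i. i \<in> {1..n} \<Longrightarrow> u i \<in> F i \<and> X i \<omega> \<in> cell i (u i)" by metis
      have "restrict u {1..n} \<in> T"
        unfolding T_def
      proof (intro CollectI conjI bexI[of _ \<omega>] ballI)
        show "restrict u {1..n} \<in> PiE {1..n} F" using u by simp
        show "X i \<omega> \<in> cell i (restrict u {1..n} i)" if "i \<in> {1..n}" for i
          using u that by simp
      qed (use \<omega> in auto)
      moreover have "\<omega> \<in> box (restrict u {1..n})" unfolding box_def using u \<omega> by auto
      ultimately show ?thesis unfolding G_def by blast
    qed (auto simp: G_def)
  qed
  ultimately show ?thesis by blast
qed

text \<open>As \<open>S\<close> is open, each point of \<open>E\<close> lies in \<open>I j\<close>
  for all large \<open>j\<close>, hence in the limit inferior of the sets \<open>G j\<close>, whose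
  probability is at most \<open>B\<close>. The limit inferior is taken because the
  \<open>G j\<close> need not be nested.\<close>

lemma measure_completion_sum_le:
  fixes X :: "nat \<Rightarrow> 'a \<Rightarrow> 's::real_normed_vector"
  assumes n: "1 \<le> n" and indep: "indep_vars (\<lambda>_. borel) X {1..n}"
    and \<alpha>: "\<And>i. i \<in> {1..n} \<Longrightarrow> 0 < \<alpha> i \<and> \<alpha> i \<le> 1"
    and conc: "\<And>i U. i \<in> {1..n} \<Longrightarrow> open U \<Longrightarrow> bounded U \<Longrightarrow> diameter U \<le> 1 \<Longrightarrow>
      prob (X i -` U \<inter> space M) \<le> \<alpha> i"
    and t: "line_coordinate R t \<tau>0 \<beta>"
    and cover: "\<And>i \<delta>. i \<in> {1..n} \<Longrightarrow> 0 < \<delta> \<Longrightarrow>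
      \<exists>d::nat \<Rightarrow> 's. range d \<subseteq> R \<and> (AE \<omega> in M. \<exists>j. X i \<omega> \<in> ball (d j) \<delta>)"
    and S: "open S" "bounded S" "diameter S \<le> 1"
  shows "measure (completion M) ((\<lambda>\<omega>. \<Sum>i=1..n. X i \<omega>) -` S \<inter> space M) \<le> window (walk \<alpha> n) 1 0"
proof -
  define B where "B = window (walk \<alpha> n) 1 0"
  define E where "E = (\<lambda>\<omega>. \<Sum>i=1..n. X i \<omega>) -` S \<inter> space M"
  define I where "I k = {\<omega> \<in> space M. ball (\<Sum>i=1..n. X i \<omega>) (1 / real (Suc k)) \<subseteq> S}" for k
  have "\<forall>k. \<exists>G\<in>events. I k \<subseteq> G \<and> prob G \<le> B + 1 / real (Suc k)"
    unfolding I_def B_def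
    by (intro allI sum_in_interior_le[OF n indep \<alpha> conc t cover S(2,3)]) auto
  then obtain G where G: "\<And>k. G k \<in> events" "\<And>k. I k \<subseteq> G k" "\<And>k. prob (G k) \<le> B + 1 / real (Suc k)"
    by metis
  define L where "L k = (\<Inter>j\<in>{k..}. G j)" for k
  have L: "L k \<in> events" for k unfolding L_def using G(1) by (intro sets.countable_INT') auto
  have "prob (L k) \<le> B" for k
  proof (rule LIMSEQ_le_const)
    show "(\<lambda>j. B + 1 / real (Suc j)) \<longlonglongrightarrow> B"
      using tendsto_add[OF tendsto_const LIMSEQ_inverse_real_of_nat, of B]
      by (simp add: inverse_eq_divide)
    show "\<exists>N. \<forall>j\<ge>N. prob (L k) \<le> B + 1 / real (Suc j)"
    proof (intro exI allI impI)
      fix j assume "k \<le> j"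
      then have "prob (L k) \<le> prob (G j)" using G(1) by (intro finite_measure_mono) (auto simp: L_def)
      then show "prob (L k) \<le> B + 1 / real (Suc j)" using G(3)[of j] by simp
    qed
  qed
  moreover have "incseq L" by (auto simp: incseq_def L_def)
  then have "(\<lambda>k. prob (L k)) \<longlonglongrightarrow> prob (\<Union>k. L k)"
    using L by (intro finite_Lim_measure_incseq) auto
  ultimately have le: "prob (\<Union>k. L k) \<le> B" by (intro LIMSEQ_le_const2) auto
  have "E \<subseteq> (\<Union>k. L k)"
  proof
    fix \<omega> assume \<omega>: "\<omega> \<in> E"
    then obtain e where e: "0 < e" "ball (\<Sum>i=1..n. X i \<omega>) e \<subseteq> S"
      using S(1) unfolding E_def open_contains_ball by auto
    obtain k where k: "1 / real (Suc k) < e" using e(1) nat_approx_posE by blast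
    have "\<omega> \<in> G j" if "k \<le> j" for j
    proof -
      have "1 / real (Suc j) \<le> 1 / real (Suc k)" using that by (intro divide_left_mono) auto
      then have "ball (\<Sum>i=1..n. X i \<omega>) (1 / real (Suc j)) \<subseteq> S"
        using e(2) k subset_ball[of "1 / real (Suc j)" e] by auto
      then have "\<omega> \<in> I j" using \<omega> by (auto simp: I_def E_def)
      then show ?thesis using G(2) by blast
    qed
    then show "\<omega> \<in> (\<Union>k. L k)" by (auto simp: L_def)
  qed
  interpret C: prob_space "completion M" by (rule prob_space_completion)
  \<comment> \<open>Monotonicity rests on measurability of the larger set; \<open>E\<close> itself
    may fail to be measurable.\<close>
  have "measure (completion M) E \<le> measure (completion M) (\<Union>k. L k)"
    using \<open>E \<subseteq> (\<Union>k. L k)\<close> L by (intro C.finite_measure_mono) auto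
  also have "\<dots> = prob (\<Union>k. L k)" using L by (intro measure_completion) auto
  finally show ?thesis using le by (simp add: E_def B_def)
qed

end

section \<open>The extremal distribution\<close>

text \<open>In units of one half, \<open>centered k\<close> is the progression that
  \<open>chain_conv\<close> sums over.\<close>

lemma centered_half_integer:
  "x \<in> centered k \<longleftrightarrow> (\<exists>i<k. x = real_of_int (2 * int i - (int k - 1)) / 2)"
proof -
  have "centered k = (\<lambda>j. real j - (real k + 1) / 2) ` Suc ` {..<k}"
    unfolding centered_def image_Suc_lessThan ..
  then show ?thesis by (auto simp: image_iff field_simps)
qed

lemma sum_centered:
  "(\<Sum>y\<in>centered k. g y) = (\<Sum>i<k. g (real_of_int (2 * int i - (int k - 1)) / 2))"
proof -
  have "centered k = (\<lambda>i. real_of_int (2 * int i - (int k - 1)) / 2) ` {..<k}"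
    using centered_half_integer[of _ k] by auto
  then show ?thesis by (simp add: sum.reindex inj_on_def)
qed

lemma card_centered: "card (centered k) = k"
  unfolding centered_def by (subst card_image) (auto simp: inj_on_def)

lemma finite_centered [simp]: "finite (centered k)"
  by (simp add: centered_def)

lemma measure_nu_star_singleton:
  assumes "0 < \<alpha>" "\<alpha> \<le> 1"
  shows "measure (nu_star \<alpha>) {y} =
    nu_star_p \<alpha> / real (nu_star_k \<alpha>) * indicator (centered (nu_star_k \<alpha>)) y
    + (1 - nu_star_p \<alpha>) / (real (nu_star_k \<alpha>) + 1) * indicator (centered (nu_star_k \<alpha> + 1)) y"
  using measure_nu_star[OF assms, of "{y}"]
  by (auto simp: card_centered indicator_def add.commute)

lemma measure_nu_star_centered:
  assumes "0 < \<alpha>" "\<alpha> \<le> 1"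
  shows "measure (nu_star \<alpha>) (centered (nu_star_k \<alpha>) \<union> centered (nu_star_k \<alpha> + 1)) = 1"
proof -
  have "centered k \<union> centered l \<in> sets borel" for k l
    by (intro borel_closed finite_imp_closed) simp
  then show ?thesis
    using nu_star_k_pos[OF assms]
    by (simp add: measure_nu_star[OF assms] card_centered Int_absorb1 Int_absorb2)
qed

context prob_space
begin

text \<open>Induction by splitting according to the value of the last variable, which almost surely
  is one of finitely many half-integers. The almost sure statement later reduces open sets to the
  half-integers in them.\<close>

lemma prob_sum_half_integer:
  fixes Y :: "nat \<Rightarrow> 'a \<Rightarrow> real"
  assumes "indep_vars (\<lambda>_. borel) Y {1..n}"
    and "\<And>i. i \<in> {1..n} \<Longrightarrow> 0 < \<alpha> i \<and> \<alpha> i \<le> 1"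
    and "\<And>i. i \<in> {1..n} \<Longrightarrow> distr M borel (Y i) = nu_star (\<alpha> i)"
  shows "(AE \<omega> in M. (\<Sum>i=1..n. Y i \<omega>) \<in> range (\<lambda>j. real_of_int j / 2)) \<and>
    (\<forall>j. prob {\<omega> \<in> space M. (\<Sum>i=1..n. Y i \<omega>) = real_of_int j / 2} = walk \<alpha> n j)"
  using assms
proof (induction n)
  case 0
  have "AE \<omega> in M. (0::real) \<in> range (\<lambda>j. real_of_int j / 2)"
    by (rule AE_I2) (auto intro: image_eqI[of _ _ 0])
  then show ?case by (simp add: prob_space)
next
  case (Suc n)
  define Z where "Z \<omega> = (\<Sum>i=1..n. Y i \<omega>)" for \<omega>
  define a where "a = \<alpha> (Suc n)"
  define k where "k = nu_star_k a"
  define A where "A = centered k \<union> centered (k + 1)"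
  have sum_eq: "(\<Sum>i=1..Suc n. Y i \<omega>) = Y (Suc n) \<omega> + Z \<omega>" for \<omega> by (simp add: Z_def)
  have a: "0 < a" "a \<le> 1" using Suc.prems(2)[of "Suc n"] by (auto simp: a_def)
  have indep: "indep_vars (\<lambda>_. borel) Y {1..n}"
    using Suc.prems(1) by (rule indep_vars_subset) auto
  have IH: "AE \<omega> in M. Z \<omega> \<in> range (\<lambda>j. real_of_int j / 2)"
    "\<And>j. prob {\<omega> \<in> space M. Z \<omega> = real_of_int j / 2} = walk \<alpha> n j"
    using Suc.IH[OF indep] Suc.prems(2,3) by (auto simp: Z_def)
  have Y: "Y i \<in> borel_measurable M" if "i \<in> {1..Suc n}" for i
    using Suc.prems(1) that by (auto simp: indep_vars_def)
  have Z: "Z \<in> borel_measurable M" unfolding Z_def using Y by (intro borel_measurable_sum) auto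
  have YS: "Y (Suc n) \<in> borel_measurable M" by (rule Y) simp
  have probY: "prob (Y (Suc n) -` B \<inter> space M) = measure (nu_star a) B" if "B \<in> sets borel" for B
    using Suc.prems(3)[of "Suc n"] measure_distr[OF YS that] by (simp add: a_def)
  have finA: "finite A" by (simp add: A_def)
  have A: "A \<in> sets borel" using finA by (intro borel_closed finite_imp_closed)
  have "prob (Y (Suc n) -` A \<inter> space M) = 1"
    using measure_nu_star_centered[OF a] probY[OF A] by (simp add: A_def k_def)
  then have "AE \<omega> in M. \<omega> \<in> Y (Suc n) -` A \<inter> space M"
    using measurable_sets[OF YS A] by (simp only: prob_eq_1)
  then have AE_A: "AE \<omega> in M. Y (Suc n) \<omega> \<in> A" by eventually_elim simp
  have half: "y \<in> range (\<lambda>j. real_of_int j / 2)" if "y \<in> A" for y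
    using that unfolding A_def Un_iff centered_half_integer by blast
  have "AE \<omega> in M. Y (Suc n) \<omega> + Z \<omega> \<in> range (\<lambda>j. real_of_int j / 2)"
    using AE_A IH(1)
  proof eventually_elim
    case (elim \<omega>)
    then obtain i j where "Y (Suc n) \<omega> = real_of_int i / 2" "Z \<omega> = real_of_int j / 2"
      using half by blast
    then have "Y (Suc n) \<omega> + Z \<omega> = real_of_int (i + j) / 2" by simp
    then show ?case by blast
  qed
  moreover have "prob {\<omega> \<in> space M. Y (Suc n) \<omega> + Z \<omega> = real_of_int j / 2} = walk \<alpha> (Suc n) j" for j
  proof -
    define D where "D y = {\<omega> \<in> space M. Y (Suc n) \<omega> = y \<and> Z \<omega> = real_of_int j / 2 - y}" for y
    have D: "D y \<in> events" for y unfolding D_def using YS Z by measurable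
    define c1 where "c1 = nu_star_p a / real k"
    define c2 where "c2 = (1 - nu_star_p a) / (real k + 1)"
    have prod: "prob (D y) = measure (nu_star a) {y} * prob {\<omega> \<in> space M. Z \<omega> = real_of_int j / 2 - y}" for y
    proof -
      have "indep_var borel (Y (Suc n)) borel Z"
        unfolding Z_def using Suc.prems(1)
        by (intro indep_vars_sum) (auto simp: atLeastAtMostSuc_conv)
      from indep_varD[OF this, of "{y}" "{real_of_int j / 2 - y}"]
      have "prob ((\<lambda>x. (Y (Suc n) x, Z x)) -` ({y} \<times> {real_of_int j / 2 - y}) \<inter> space M)
        = measure (nu_star a) {y} * prob (Z -` {real_of_int j / 2 - y} \<inter> space M)"
        by (simp add: probY)
      moreover have "(\<lambda>x. (Y (Suc n) x, Z x)) -` ({y} \<times> {real_of_int j / 2 - y}) \<inter> space M = D y"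
        by (auto simp: D_def)
      moreover have "Z -` {real_of_int j / 2 - y} \<inter> space M = {\<omega> \<in> space M. Z \<omega> = real_of_int j / 2 - y}"
        by auto
      ultimately show ?thesis by simp
    qed
    define q where "q y = prob {\<omega> \<in> space M. Z \<omega> = real_of_int j / 2 - y}" for y
    have conv: "(\<Sum>y\<in>centered l. q y) = chain_conv l (walk \<alpha> n) j" for l
    proof -
      have "(\<Sum>y\<in>centered l. q y) = (\<Sum>i<l. walk \<alpha> n (j - (2 * int i - (int l - 1))))"
        unfolding sum_centered q_def
        by (intro sum.cong refl) (simp flip: IH(2) add: field_simps)
      \<comment> \<open>The progression is symmetric about 0, so reading it backwards changes its
        sign.\<close>
      also have "\<dots> = (\<Sum>i<l. walk \<alpha> n (j - (2 * int (l - Suc i) - (int l - 1))))"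
        by (rule sum.nat_diff_reindex[symmetric])
      also have "\<dots> = chain_conv l (walk \<alpha> n) j"
        unfolding chain_conv_def
        by (intro sum.cong refl arg_cong[of _ _ "walk \<alpha> n"]) (auto simp: of_nat_diff)
      finally show ?thesis .
    qed
    have "prob {\<omega> \<in> space M. Y (Suc n) \<omega> + Z \<omega> = real_of_int j / 2} = prob (\<Union>y\<in>A. D y)"
    proof (rule finite_measure_eq_AE)
      show "AE \<omega> in M. \<omega> \<in> {\<omega> \<in> space M. Y (Suc n) \<omega> + Z \<omega> = real_of_int j / 2} \<longleftrightarrow> \<omega> \<in> (\<Union>y\<in>A. D y)"
        using AE_A by eventually_elim (auto simp: D_def)
      show "{\<omega> \<in> space M. Y (Suc n) \<omega> + Z \<omega> = real_of_int j / 2} \<in> events" using YS Z by measurable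
      show "(\<Union>y\<in>A. D y) \<in> events" using D finA by auto
    qed
    also have "\<dots> = (\<Sum>y\<in>A. prob (D y))"
      using finA D by (intro finite_measure_finite_Union) (auto simp: disjoint_family_on_def D_def)
    also have "\<dots> = (\<Sum>y\<in>A. c1 * (indicator (centered k) y * q y) + c2 * (indicator (centered (k + 1)) y * q y))"
      by (intro sum.cong refl)
        (simp add: prod measure_nu_star_singleton[OF a] c1_def c2_def k_def q_def algebra_simps)
    also have "\<dots> = c1 * (\<Sum>y\<in>A. indicator (centered k) y * q y)
        + c2 * (\<Sum>y\<in>A. indicator (centered (k + 1)) y * q y)"
      by (simp only: sum.distrib sum_distrib_left)
    also have "(\<Sum>y\<in>A. indicator (centered k) y * q y) = (\<Sum>y\<in>centered k. q y)"
      using finA by (intro sum.mono_neutral_cong_right) (auto simp: A_def indicator_def)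
    also have "(\<Sum>y\<in>A. indicator (centered (k + 1)) y * q y) = (\<Sum>y\<in>centered (k + 1). q y)"
      using finA by (intro sum.mono_neutral_cong_right) (auto simp: A_def indicator_def)
    finally show ?thesis by (simp add: conv nu_conv_def c1_def c2_def k_def a_def)
  qed
  ultimately show ?case unfolding sum_eq by blast
qed

text \<open>The sum lives on the half-integers, of which an open set of diameter at most 1 contains
  at most two, and these are consecutive. Among such pairs \<open>{0, 1 / 2}\<close> has the largest
  mass by unimodality.\<close>

lemma concentration_sum_nu_star:
  fixes Y :: "nat \<Rightarrow> 'a \<Rightarrow> real"
  assumes indep: "indep_vars (\<lambda>_. borel) Y {1..n}"
    and \<alpha>: "\<And>i. i \<in> {1..n} \<Longrightarrow> 0 < \<alpha> i \<and> \<alpha> i \<le> 1"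
    and Y: "\<And>i. i \<in> {1..n} \<Longrightarrow> distr M borel (Y i) = nu_star (\<alpha> i)"
  shows "concentration M (\<lambda>\<omega>. \<Sum>i=1..n. Y i \<omega>) 1 = window (walk \<alpha> n) 1 0"
    and "prob {\<omega> \<in> space M. (\<Sum>i=1..n. Y i \<omega>) \<in> {0, 1 / 2}} = window (walk \<alpha> n) 1 0"
proof -
  define Z where "Z \<omega> = (\<Sum>i=1..n. Y i \<omega>)" for \<omega>
  have half: "AE \<omega> in M. Z \<omega> \<in> range (\<lambda>j. real_of_int j / 2)"
    and pt: "\<And>j. prob {\<omega> \<in> space M. Z \<omega> = real_of_int j / 2} = walk \<alpha> n j"
    using prob_sum_half_integer[OF indep \<alpha> Y] by (auto simp: Z_def)
  have Z: "Z \<in> borel_measurable M"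
    unfolding Z_def using indep by (intro borel_measurable_sum) (auto simp: indep_vars_def)
  have f: "sym_unimodal (walk \<alpha> n)" using \<alpha> by (rule sym_unimodal_walk)
  have window_1: "window (walk \<alpha> n) 1 j = walk \<alpha> n j + walk \<alpha> n (j + 1)" for j
    using window_Suc[of "walk \<alpha> n" 0 j] by simp
  have pair: "prob {\<omega> \<in> space M. Z \<omega> \<in> {real_of_int j / 2, real_of_int (j + 1) / 2}}
      = window (walk \<alpha> n) 1 j" for j
  proof -
    have "{\<omega> \<in> space M. Z \<omega> \<in> {real_of_int j / 2, real_of_int (j + 1) / 2}}
      = {\<omega> \<in> space M. Z \<omega> = real_of_int j / 2} \<union> {\<omega> \<in> space M. Z \<omega> = real_of_int (j + 1) / 2}" by auto
    moreover have ev: "{\<omega> \<in> space M. Z \<omega> = y} \<in> events" for y using Z by measurable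
    have "prob ({\<omega> \<in> space M. Z \<omega> = y} \<union> {\<omega> \<in> space M. Z \<omega> = z})
      = prob {\<omega> \<in> space M. Z \<omega> = y} + prob {\<omega> \<in> space M. Z \<omega> = z}" if "y \<noteq> z" for y z
      using that by (intro finite_measure_Union ev) auto
    from this[of "real_of_int j / 2" "real_of_int (j + 1) / 2"]
    have "prob ({\<omega> \<in> space M. Z \<omega> = real_of_int j / 2} \<union> {\<omega> \<in> space M. Z \<omega> = real_of_int (j + 1) / 2})
      = walk \<alpha> n j + walk \<alpha> n (j + 1)"
      unfolding pt by simp
    ultimately show ?thesis by (simp only: window_1)
  qed
  show *: "prob {\<omega> \<in> space M. (\<Sum>i=1..n. Y i \<omega>) \<in> {0, 1 / 2}} = window (walk \<alpha> n) 1 0"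
    using pair[of 0] by (simp add: Z_def)
  have max: "window (walk \<alpha> n) 1 j \<le> window (walk \<alpha> n) 1 0" for j
  proof (cases "0 \<le> j")
    case True
    then show ?thesis using window_antimono[OF f] antimonoD[of _ 0 "nat j"] by force
  next
    case False
    \<comment> \<open>A negative shift is reflected to the nonnegative shift
      \<open>- j - 1\<close>.\<close>
    have "window (walk \<alpha> n) 1 (- (- j)) = window (walk \<alpha> n) 1 (- j - 1)"
      by (rule window_reflect) (rule sym_unimodalD(2)[OF f])
    with False show ?thesis
      using window_antimono[OF f, of 1] antimonoD[of _ 0 "nat (- j - 1)"] by force
  qed
  let ?\<S> = "{S :: real set. open S \<and> bounded S \<and> diameter S \<le> 1}"
  have "(SUP S\<in>?\<S>. prob (Z -` S \<inter> space M)) = window (walk \<alpha> n) 1 0"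
  proof (rule cSup_eq_maximum)
    \<comment> \<open>The interval from \<open>- 1 / 4\<close> to \<open>3 / 4\<close> has diameter
      1, and its half-integers are 0 and \<open>1 / 2\<close>.\<close>
    have "Z -` ball (1 / 4) (1 / 2) \<inter> space M \<in> events" using Z by (rule measurable_sets) simp
    then have "prob (Z -` ball (1 / 4) (1 / 2) \<inter> space M) = prob {\<omega> \<in> space M. Z \<omega> \<in> {0, 1 / 2}}"
    proof (intro finite_measure_eq_AE)
      show "AE \<omega> in M. \<omega> \<in> Z -` ball (1 / 4) (1 / 2) \<inter> space M \<longleftrightarrow> \<omega> \<in> {\<omega> \<in> space M. Z \<omega> \<in> {0, 1 / 2}}"
        using half
      proof eventually_elim
        case (elim \<omega>)
        then obtain j where j: "Z \<omega> = real_of_int j / 2" by blast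
        have "dist (1 / 4) (real_of_int j / 2) < 1 / 2 \<longleftrightarrow> real_of_int j / 2 \<in> {0, 1 / 2}"
          by (auto simp: dist_real_def abs_if field_simps split: if_splits)
        then show ?case by (auto simp: j)
      qed
      show "{\<omega> \<in> space M. Z \<omega> \<in> {0, 1 / 2}} \<in> events" using Z by measurable
    qed
    then show "window (walk \<alpha> n) 1 0 \<in> (\<lambda>S. prob (Z -` S \<inter> space M)) ` ?\<S>"
      using * by (intro image_eqI[of _ _ "ball (1 / 4) (1 / 2)"]) (auto simp: Z_def)
    fix x assume "x \<in> (\<lambda>S. prob (Z -` S \<inter> space M)) ` ?\<S>"
    then obtain S where S: "x = prob (Z -` S \<inter> space M)" "open S" "bounded S" "diameter S \<le> 1" by auto
    \<comment> \<open>Distance exactly 1 is excluded too: a ball in \<open>S\<close> around one of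
      the points would stretch the diameter beyond 1.\<close>
    have close: "j \<le> i + 1" if in_S: "real_of_int i / 2 \<in> S" "real_of_int j / 2 \<in> S" for i j
    proof (rule ccontr)
      assume "\<not> j \<le> i + 1"
      then have ij: "i + 2 \<le> j" by simp
      obtain e where e: "0 < e" "ball (real_of_int j / 2) e \<subseteq> S"
        using S(2) in_S(2) open_contains_ball by blast
      have "dist (real_of_int j / 2) (real_of_int i / 2) \<le> 1 - 3 / 4 * e"
        using e in_S(1) S(3,4) ij by (intro dist_le_of_ball_subset) auto
      moreover have "1 \<le> dist (real_of_int j / 2) (real_of_int i / 2)"
        using ij by (simp add: dist_real_def)
      ultimately show False using e(1) by simp
    qed
    \<comment> \<open>Take for \<open>j\<close> the leftmost half-integer of \<open>S\<close>. If
      every one had its left neighbour in \<open>S\<close>, any of them would bring along another at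
      distance 1.\<close>
    have "\<exists>j. \<forall>i. real_of_int i / 2 \<in> S \<longrightarrow> i = j \<or> i = j + 1"
    proof (cases "\<exists>i. real_of_int i / 2 \<in> S \<and> real_of_int (i - 1) / 2 \<notin> S")
      case True
      then obtain i where i: "real_of_int i / 2 \<in> S" "real_of_int (i - 1) / 2 \<notin> S" by blast
      have "l = i \<or> l = i + 1" if l: "real_of_int l / 2 \<in> S" for l
        using close[OF i(1) l] close[OF l i(1)] i(2) l by (cases "l = i - 1") auto
      then show ?thesis by blast
    next
      case False
      have "real_of_int i / 2 \<notin> S" for i
      proof
        assume i: "real_of_int i / 2 \<in> S"
        then have "real_of_int (i - 1) / 2 \<in> S" using False by blast
        then have "real_of_int (i - 1 - 1) / 2 \<in> S" using False by blast
        then show False using close[of "i - 1 - 1" i] i by simp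
      qed
      then show ?thesis by blast
    qed
    then obtain j where j: "\<And>i. real_of_int i / 2 \<in> S \<Longrightarrow> i = j \<or> i = j + 1" by blast
    have "x \<le> prob {\<omega> \<in> space M. Z \<omega> \<in> {real_of_int j / 2, real_of_int (j + 1) / 2}}"
      unfolding S(1)
    proof (rule finite_measure_mono_AE)
      show "AE \<omega> in M. \<omega> \<in> Z -` S \<inter> space M \<longrightarrow>
          \<omega> \<in> {\<omega> \<in> space M. Z \<omega> \<in> {real_of_int j / 2, real_of_int (j + 1) / 2}}"
        using half
      proof eventually_elim
        case (elim \<omega>)
        then obtain i where i: "Z \<omega> = real_of_int i / 2" by blast
        then show ?case using j[of i, folded i] by auto
      qed
      show "{\<omega> \<in> space M. Z \<omega> \<in> {real_of_int j / 2, real_of_int (j + 1) / 2}} \<in> events"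
        using Z by measurable
    qed
    then show "x \<le> window (walk \<alpha> n) 1 0" using pair[of j] max[of j] by simp
  qed
  then show "concentration M (\<lambda>\<omega>. \<Sum>i=1..n. Y i \<omega>) 1 = window (walk \<alpha> n) 1 0"
    using concentration_measurable[OF Z, of 1] unfolding Z_def[abs_def] by (rule trans[rotated])
qed

end

section \<open>Countable covers\<close>

text \<open>A real number fits strictly between each supremum and \<open>b\<close>, and finitely
  many such numbers have a maximum. Suprema in \<open>ereal\<close> are meaningful for unbounded
  values and empty \<open>A\<close> as well.\<close>

lemma uniform_strict_bound:
  fixes g :: "'i \<Rightarrow> 'a \<Rightarrow> real"
  assumes "finite I" "\<And>i. i \<in> I \<Longrightarrow> (SUP x\<in>A. ereal (g i x)) < ereal b"
  shows "\<exists>s<b. \<forall>i\<in>I. \<forall>x\<in>A. g i x < s"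
proof -
  have "\<forall>i\<in>I. \<exists>z<b. \<forall>x\<in>A. g i x < z"
  proof
    fix i assume "i \<in> I"
    then obtain z where z: "(SUP x\<in>A. ereal (g i x)) < ereal z" "z < b"
      using ereal_dense2[OF assms(2)] by auto
    have "g i x < z" if "x \<in> A" for x
      using le_less_trans[OF SUP_upper[OF that] z(1)] by simp
    with z(2) show "\<exists>z<b. \<forall>x\<in>A. g i x < z" by blast
  qed
  then obtain \<zeta> where \<zeta>: "\<And>i. i \<in> I \<Longrightarrow> \<zeta> i < b" "\<And>i x. i \<in> I \<Longrightarrow> x \<in> A \<Longrightarrow> g i x < \<zeta> i"
    by metis
  \<comment> \<open>The element \<open>b - 1\<close> provides for empty \<open>I\<close>.\<close>
  let ?s = "Max (insert (b - 1) (\<zeta> ` I))"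
  show ?thesis
  proof (intro exI[of _ ?s] conjI ballI)
    show "?s < b" using assms(1) \<zeta>(1) by (subst Max_less_iff) auto
    fix i x assume "i \<in> I" "x \<in> A"
    then have "g i x < \<zeta> i" "\<zeta> i \<le> ?s" using assms(1) \<zeta>(2) by auto
    then show "g i x < ?s" by simp
  qed
qed

context prob_space
begin

lemma concentration_ge:
  assumes "open S" "bounded S" "diameter S \<le> t"
  shows "measure (completion M) (X -` S \<inter> space M) \<le> concentration M X t"
proof -
  interpret C: prob_space "completion M" by (rule prob_space_completion)
  show ?thesis
    unfolding concentration_def using assms
    by (intro cSUP_upper bdd_aboveI2[where M = 1]) auto
qed

lemma cover_sequence:
  fixes X :: "'a \<Rightarrow> 's::metric_space"
  assumes "countable C" "C \<subseteq> R" "AE \<omega> in M. \<exists>c\<in>C. X \<omega> \<in> ball c \<delta>"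
  shows "\<exists>d::nat \<Rightarrow> 's. range d \<subseteq> R \<and> (AE \<omega> in M. \<exists>j. X \<omega> \<in> ball (d j) \<delta>)"
proof -
  \<comment> \<open>Under a probability measure a contradiction cannot hold almost
    everywhere.\<close>
  have "C \<noteq> {}" using assms(3) by auto
  then have eq: "range (from_nat_into C) = C" using assms(1) by (rule range_from_nat_into)
  have "AE \<omega> in M. \<exists>j. X \<omega> \<in> ball (from_nat_into C j) \<delta>"
    using assms(3)
  proof eventually_elim
    case (elim \<omega>)
    then obtain c where "c \<in> C" "X \<omega> \<in> ball c \<delta>" by blast
    moreover from this(1) obtain j where "c = from_nat_into C j" using eq by blast
    ultimately show ?case by blast
  qed
  then show ?thesis using eq assms(2) by blast
qed

lemma cover_sequence_countable_support:
  fixes X :: "'a \<Rightarrow> 's::metric_space"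
  assumes "countable C" "AE \<omega> in M. X \<omega> \<in> C" "\<And>\<omega>. \<omega> \<in> space M \<Longrightarrow> X \<omega> \<in> R" "0 < \<delta>"
  shows "\<exists>d::nat \<Rightarrow> 's. range d \<subseteq> R \<and> (AE \<omega> in M. \<exists>j. X \<omega> \<in> ball (d j) \<delta>)"
proof (rule cover_sequence)
  show "countable (C \<inter> R)" "C \<inter> R \<subseteq> R" using assms(1) by auto
  show "AE \<omega> in M. \<exists>c\<in>C \<inter> R. X \<omega> \<in> ball c \<delta>"
    using assms(2) AE_space
  proof eventually_elim
    case (elim \<omega>)
    then show ?case using assms(3,4) by (intro bexI[of _ "X \<omega>"]) auto
  qed
qed

text \<open>The centres must lie in \<open>R\<close>, where the line coordinate is controlled. A
  dense point within \<open>\<delta> / 2\<close> of a point of \<open>R\<close> is replaced by such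
  a point, which doubles the radius.\<close>

lemma cover_sequence_separable:
  fixes X :: "'a \<Rightarrow> 's::metric_space"
  assumes "separable_space (euclidean :: 's topology)" "\<And>\<omega>. \<omega> \<in> space M \<Longrightarrow> X \<omega> \<in> R" "0 < \<delta>"
  shows "\<exists>d::nat \<Rightarrow> 's. range d \<subseteq> R \<and> (AE \<omega> in M. \<exists>j. X \<omega> \<in> ball (d j) \<delta>)"
proof -
  obtain D :: "'s set" where D: "countable D" "closure D = UNIV"
    using assms(1) unfolding separable_space_def by auto
  define D' where "D' = {x \<in> D. ball x (\<delta> / 2) \<inter> R \<noteq> {}}"
  define c where "c x = (SOME y. y \<in> ball x (\<delta> / 2) \<inter> R)" for x
  have c: "c x \<in> ball x (\<delta> / 2)" "c x \<in> R" if "x \<in> D'" for x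
    using that someI_ex[of "\<lambda>y. y \<in> ball x (\<delta> / 2) \<inter> R"] unfolding c_def D'_def by blast+
  show ?thesis
  proof (rule cover_sequence)
    show "countable (c ` D')" using D(1) by (simp add: D'_def)
    show "c ` D' \<subseteq> R" using c(2) by auto
    show "AE \<omega> in M. \<exists>y\<in>c ` D'. X \<omega> \<in> ball y \<delta>"
    proof (rule AE_I2)
      fix \<omega> assume \<omega>: "\<omega> \<in> space M"
      have "X \<omega> \<in> closure D" using D(2) by simp
      then obtain x where x: "x \<in> D" "dist x (X \<omega>) < \<delta> / 2"
        using assms(3) unfolding closure_approachable by (metis half_gt_zero)
      then have "x \<in> D'" using assms(2)[OF \<omega>] by (auto simp: D'_def)
      moreover have "dist (c x) (X \<omega>) < \<delta>"
        using c(1)[OF \<open>x \<in> D'\<close>] x(2) dist_triangle2[of "c x" "X \<omega>" x]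
        by (simp add: dist_commute)
      ultimately show "\<exists>y\<in>c ` D'. X \<omega> \<in> ball y \<delta>" by auto
    qed
  qed
qed

end

theorem theorem2p2:
  fixes M :: "'a measure" and X :: "nat \<Rightarrow> 'a \<Rightarrow> 's::real_normed_vector"
    and N :: "'b measure" and Y :: "nat \<Rightarrow> 'b \<Rightarrow> real"
    and \<alpha> :: "nat \<Rightarrow> real" and n :: nat
  assumes "n \<ge> 1"
    and "prob_space M"
    and "prob_space.indep_vars M (\<lambda>_. borel) X {1..n}"
    and "\<And>i. i \<in> {1..n} \<Longrightarrow> 0 < \<alpha> i \<and> \<alpha> i \<le> 1"
    and "\<And>i. i \<in> {1..n} \<Longrightarrow> concentration M (X i) 1 \<le> \<alpha> i"
    and "\<exists>L. line L \<and>
      ((\<forall>i\<in>{1..n}. (SUP \<omega>\<in>space M. ereal (infdist (X i \<omega>) L)) < ereal (1 / 8)) \<or>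
       hilbert_space TYPE('s) \<and>
       (\<forall>i\<in>{1..n}. (SUP \<omega>\<in>space M. ereal (infdist (X i \<omega>) L)) < ereal (sqrt 3 / 4)))"
    and "(\<forall>i\<in>{1..n}. \<exists>C. countable C \<and> (AE \<omega> in M. X i \<omega> \<in> C)) \<or>
      Topological_Spaces.complete (UNIV :: 's set) \<and> separable_space (euclidean :: 's topology)"
    and "prob_space N"
    and "prob_space.indep_vars N (\<lambda>_. borel) Y {1..n}"
    and "\<And>i. i \<in> {1..n} \<Longrightarrow> distr N borel (Y i) = nu_star (\<alpha> i)"
  shows "concentration M (\<lambda>\<omega>. \<Sum>i=1..n. X i \<omega>) 1 \<le> concentration N (\<lambda>\<omega>. \<Sum>i=1..n. Y i \<omega>) 1 \<and>
    concentration N (\<lambda>\<omega>. \<Sum>i=1..n. Y i \<omega>) 1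
      = measure N {\<omega> \<in> space N. (\<Sum>i=1..n. Y i \<omega>) \<in> {0, 1 / 2}}"
proof -
  interpret M: prob_space M by fact
  interpret N: prob_space N by fact
  have meas: "X i \<in> borel_measurable M" if "i \<in> {1..n}" for i
    using assms(3) that by (auto simp: M.indep_vars_def)
  have conc: "measure M (X i -` U \<inter> space M) \<le> \<alpha> i"
    if "i \<in> {1..n}" "open U" "bounded U" "diameter U \<le> 1" for i U
  proof -
    have "X i -` U \<inter> space M \<in> sets M" using that meas by (intro measurable_sets) auto
    then have "measure M (X i -` U \<inter> space M) \<le> concentration M (X i) 1"
      using M.concentration_ge[OF that(2-4), of "X i"] by simp
    then show ?thesis using assms(5)[OF that(1)] by simp
  qed
  have "\<exists>R t \<tau> \<beta>. line_coordinate R t \<tau> \<beta> \<and> (\<forall>i\<in>{1..n}. \<forall>\<omega>\<in>space M. X i \<omega> \<in> R)"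
  proof -
    obtain L where L: "line L" and near:
      "(\<forall>i\<in>{1..n}. (SUP \<omega>\<in>space M. ereal (infdist (X i \<omega>) L)) < ereal (1 / 8)) \<or>
       hilbert_space TYPE('s) \<and>
       (\<forall>i\<in>{1..n}. (SUP \<omega>\<in>space M. ereal (infdist (X i \<omega>) L)) < ereal (sqrt 3 / 4))"
      using assms(6) by blast
    obtain v b where v: "norm v = 1" and L_eq: "L = {a *\<^sub>R v + b | a. True}"
      using L unfolding line_def by blast
    \<comment> \<open>Strictness of the suprema gives one \<open>s\<close> for all \<open>i\<close>,
      so a single strip and a single coordinate serve all the \<open>X i\<close>.\<close>
    have "\<exists>s. (s < 1 / 8 \<or> hilbert_space TYPE('s) \<and> s < sqrt 3 / 4) \<and>
        (\<forall>i\<in>{1..n}. \<forall>\<omega>\<in>space M. infdist (X i \<omega>) L < s)"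
      using near
    proof (elim disjE conjE)
      assume "\<forall>i\<in>{1..n}. (SUP \<omega>\<in>space M. ereal (infdist (X i \<omega>) L)) < ereal (1 / 8)"
      then show ?thesis
        using uniform_strict_bound[of "{1..n}" "\<lambda>i \<omega>. infdist (X i \<omega>) L" "space M" "1 / 8"] by blast
    next
      assume "hilbert_space TYPE('s)"
        "\<forall>i\<in>{1..n}. (SUP \<omega>\<in>space M. ereal (infdist (X i \<omega>) L)) < ereal (sqrt 3 / 4)"
      then show ?thesis
        using uniform_strict_bound[of "{1..n}" "\<lambda>i \<omega>. infdist (X i \<omega>) L" "space M" "sqrt 3 / 4"] by blast
    qed
    then obtain s where s: "s < 1 / 8 \<or> hilbert_space TYPE('s) \<and> s < sqrt 3 / 4"
      and in_R: "\<forall>i\<in>{1..n}. \<forall>\<omega>\<in>space M. infdist (X i \<omega>) L < s" by blast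
    have "\<exists>t \<tau> \<beta>. line_coordinate {x. infdist x L < s} t \<tau> \<beta>"
      using s line_coordinate_normed[OF v, of s b] line_coordinate_hilbert[OF v, of s b]
      unfolding L_eq by blast
    then obtain t \<tau> \<beta> where "line_coordinate {x. infdist x L < s} t \<tau> \<beta>" by blast
    then show ?thesis using in_R by (intro exI[of _ "{x. infdist x L < s}"] exI[of _ t] exI[of _ \<tau>] exI[of _ \<beta>]) simp
  qed
  then obtain R t \<tau> \<beta> where t: "line_coordinate R t \<tau> \<beta>"
    and in_R: "\<And>i \<omega>. i \<in> {1..n} \<Longrightarrow> \<omega> \<in> space M \<Longrightarrow> X i \<omega> \<in> R" by blast
  have cover: "\<exists>d::nat \<Rightarrow> 's. range d \<subseteq> R \<and> (AE \<omega> in M. \<exists>j. X i \<omega> \<in> ball (d j) \<delta>)"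
    if i: "i \<in> {1..n}" and "0 < \<delta>" for i \<delta>
    using assms(7)
  proof
    assume "\<forall>i\<in>{1..n}. \<exists>C. countable C \<and> (AE \<omega> in M. X i \<omega> \<in> C)"
    then obtain C where "countable C" "AE \<omega> in M. X i \<omega> \<in> C" using i by blast
    then show ?thesis using in_R[OF i] \<open>0 < \<delta>\<close> by (rule M.cover_sequence_countable_support)
  next
    assume "Topological_Spaces.complete (UNIV :: 's set) \<and> separable_space (euclidean :: 's topology)"
    then show ?thesis using in_R[OF i] \<open>0 < \<delta>\<close> by (intro M.cover_sequence_separable) auto
  qed
  \<comment> \<open>The two concentrations are compared through the mass of
    \<open>{0, 1 / 2}\<close> under the extremal walk, the window for antichains.\<close>
  have "concentration M (\<lambda>\<omega>. \<Sum>i=1..n. X i \<omega>) 1 \<le> window (walk \<alpha> n) 1 0"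
    unfolding concentration_def
  proof (rule cSUP_least)
    show "{S :: 's set. open S \<and> bounded S \<and> diameter S \<le> 1} \<noteq> {}"
      by (auto intro!: exI[of _ "{}"])
    fix S :: "'s set" assume S: "S \<in> {S. open S \<and> bounded S \<and> diameter S \<le> 1}"
    show "measure (completion M) ((\<lambda>\<omega>. \<Sum>i=1..n. X i \<omega>) -` S \<inter> space M) \<le> window (walk \<alpha> n) 1 0"
      using S by (intro M.measure_completion_sum_le[OF assms(1,3,4) conc t cover]) auto
  qed
  moreover note N.concentration_sum_nu_star[OF assms(9,4,10)]
  ultimately show ?thesis by simp
qed

end
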